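(* Let $(M,d)$ be a complete pointed metric space with base point $0$, and let $\mu$ be a positive Radon measure on $\beta\widetilde{M}$ that is $\preccurlyeq$-minimal and concentrated on $d^{-1}[0,\infty)$. Then $p_1(\operatorname{supp}\mu)\cup p_2(\operatorname{supp}\mu)\subset \operatorname{esupp}(\Phi^*\mu)\cup\{0\}$.
   Context: $\mathrm{Lip}_0(M)$: Lipschitz $f:M\to\mathbb{R}$ with $f(0)=0$ normed by the Lipschitz constant. $\widetilde{M}=\{(x,y)\in M\times M:x\ne y\}$, $\beta\widetilde{M}$ its Stone–Čech compactification; Radon measures on it are identified with $C(\beta\widetilde{M})^*$ and $\operatorname{supp}\mu$ is the usual (closed) support. $d:\beta\widetilde{M}\to[0,\infty]$ is the continuous extension of $(x,y)\mapsto d(x,y)$. $\Phi:\mathrm{Lip}_0(M)\to C(\beta\widetilde{M})$ maps $f$ to the continuous extension of $(x,y)\mapsto(f(x)-f(y))/d(x,y)$, $\Phi^*:C(\beta\widetilde{M})^*\to\mathrm{Lip}_0(M)^*$ its adjoint. $M^u$ is the uniform (Samuel) compactification of $M$; $p_1,p_2:\beta\widetilde{M}\to M^u$ are the continuous extensions of $(x,y)\mapsto x$, $(x,y)\mapsto y$. For $\psi\in\mathrm{Lip}_0(M)^*$, its extended support is $\operatorname{esupp}(\psi)=\bigcap\{\overline{A}^{M^u}: A\subset M$ and $\langle f,\psi\rangle=0$ whenever $f\in\mathrm{Lip}_0(M)$ and $f|_A=0\}$. $G$ is the set of $g\in C(\beta\widetilde{M})$ with $d(x,y)g(x,y)\le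 d(x,u)g(x,u)+d(u,y)g(u,y)$ for distinct $x,u,y\in M$; $\mu\preccurlyeq\nu$ iff $\int g\,d\mu\le\int g\,d\nu$ for all $g\in G$; $\mu$ is $\preccurlyeq$-minimal if every positive $\nu\preccurlyeq\mu$ satisfies $\mu\preccurlyeq\nu$. Throughout, $M$ has at least three distinct points. *)

theory Defs
  imports "HOL-Analysis.Analysis" "HOL-Probability.Probability"
begin

definition Mtilde :: "('a \<times> 'a) set" where
  "Mtilde = {p. fst p \<noteq> snd p}"

section \<open>Stone-Cech compactification of Mtilde (evaluation construction)\<close>

definition Cb_tilde :: "('a::metric_space \<times> 'a \<Rightarrow> real) set" where
  "Cb_tilde = {g. continuous_on Mtilde g \<and> bounded (g ` Mtilde) \<and> (\<forall>p. p \<notin> Mtilde \<longrightarrow> g p = 0)}"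

definition evb :: "'a::metric_space \<times> 'a \<Rightarrow> (('a \<times> 'a \<Rightarrow> real) \<Rightarrow> real)" where
  "evb p = (\<lambda>g. if g \<in> Cb_tilde then g p else 0)"

text \<open>betaMtilde: closure of the evaluation image (product topology); the points
  xi of betaMtilde act on g in Cb_tilde by xi g = continuous extension of g at xi.\<close>
definition betaM :: "(('a::metric_space \<times> 'a \<Rightarrow> real) \<Rightarrow> real) set" where
  "betaM = closure (evb ` Mtilde)"

section \<open>Uniform (Samuel) compactification of M\<close>

definition Ub :: "('a::metric_space \<Rightarrow> real) set" where
  "Ub = {f. uniformly_continuous_on UNIV f \<and> bounded (range f)}"

definition evu :: "'a::metric_space \<Rightarrow> (('a \<Rightarrow> real) \<Rightarrow> real)" where
  "evu x = (\<lambda>f. if f \<in> Ub then f x else 0)"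

definition Mu :: "(('a::metric_space \<Rightarrow> real) \<Rightarrow> real) set" where
  "Mu = closure (range evu)"

text \<open>Extension of d to betaMtilde with values in [0,\<infinity>]:
  supremum of the extensions of the bounded functions min(d,n).\<close>
definition dext :: "(('a::metric_space \<times> 'a \<Rightarrow> real) \<Rightarrow> real) \<Rightarrow> ereal" where
  "dext \<xi> = (SUP n::nat. ereal (\<xi> (\<lambda>p. if p \<in> Mtilde then min (dist (fst p) (snd p)) (real n) else 0)))"

text \<open>p1, p2: continuous extensions of (x,y) \<mapsto> x and (x,y) \<mapsto> y.\<close>
definition p1 :: "(('a::metric_space \<times> 'a \<Rightarrow> real) \<Rightarrow> real) \<Rightarrow> (('a \<Rightarrow> real) \<Rightarrow> real)" where
  "p1 \<xi> = (\<lambda>f. if f \<in> Ub then \<xi> (\<lambda>p. if p \<in> Mtilde then f (fst p) else 0) else 0)"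

definition p2 :: "(('a::metric_space \<times> 'a \<Rightarrow> real) \<Rightarrow> real) \<Rightarrow> (('a \<Rightarrow> real) \<Rightarrow> real)" where
  "p2 \<xi> = (\<lambda>f. if f \<in> Ub then \<xi> (\<lambda>p. if p \<in> Mtilde then f (snd p) else 0) else 0)"

definition Lip0 :: "'a::metric_space \<Rightarrow> ('a \<Rightarrow> real) set" where
  "Lip0 z = {f. (\<exists>L. L-lipschitz_on UNIV f) \<and> f z = 0}"

text \<open>Phi f = continuous extension of the difference quotient (f(x)-f(y))/d(x,y).\<close>
definition Phi :: "('a::metric_space \<Rightarrow> real) \<Rightarrow> (('a \<times> 'a \<Rightarrow> real) \<Rightarrow> real) \<Rightarrow> real" where
  "Phi f \<xi> = \<xi> (\<lambda>p. (f (fst p) - f (snd p)) / dist (fst p) (snd p))"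

definition Phi_star :: "(('a::metric_space \<times> 'a \<Rightarrow> real) \<Rightarrow> real) measure \<Rightarrow> ('a \<Rightarrow> real) \<Rightarrow> real" where
  "Phi_star \<mu> f = integral\<^sup>L \<mu> (Phi f)"

definition esupp :: "'a::metric_space \<Rightarrow> (('a \<Rightarrow> real) \<Rightarrow> real) \<Rightarrow> (('a \<Rightarrow> real) \<Rightarrow> real) set" where
  "esupp z \<psi> = \<Inter> {closure (evu ` A) | A. \<forall>f \<in> Lip0 z. (\<forall>x\<in>A. f x = 0) \<longrightarrow> \<psi> f = 0}"

definition radon_on :: "'b::topological_space set \<Rightarrow> 'b measure \<Rightarrow> bool" where
  "radon_on S \<mu> \<longleftrightarrow> space \<mu> = S \<and> sets \<mu> = sets (restrict_space borel S) \<and>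
     finite_measure \<mu> \<and>
     (\<forall>B \<in> sets \<mu>. emeasure \<mu> B = (SUP K \<in> {K. compact K \<and> K \<subseteq> B}. emeasure \<mu> K))"

definition supp :: "'b::topological_space set \<Rightarrow> 'b measure \<Rightarrow> 'b set" where
  "supp S \<mu> = {\<xi> \<in> S. \<forall>U. open U \<and> \<xi> \<in> U \<longrightarrow> emeasure \<mu> (U \<inter> S) > 0}"

definition Gset :: "((('a::metric_space \<times> 'a \<Rightarrow> real) \<Rightarrow> real) \<Rightarrow> real) set" where
  "Gset = {g. continuous_on betaM g \<and>
     (\<forall>x u y. x \<noteq> u \<and> u \<noteq> y \<and> x \<noteq> y \<longrightarrow>
        dist x y * g (evb (x, y)) \<le> dist x u * g (evb (x, u)) + dist u y * g (evb (u, y)))}"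

definition preceq :: "(('a::metric_space \<times> 'a \<Rightarrow> real) \<Rightarrow> real) measure \<Rightarrow> (('a \<times> 'a \<Rightarrow> real) \<Rightarrow> real) measure \<Rightarrow> bool" where
  "preceq \<mu> \<nu> \<longleftrightarrow> (\<forall>g \<in> Gset. integral\<^sup>L \<mu> g \<le> integral\<^sup>L \<nu> g)"

definition preceq_minimal :: "(('a::metric_space \<times> 'a \<Rightarrow> real) \<Rightarrow> real) measure \<Rightarrow> bool" where
  "preceq_minimal \<mu> \<longleftrightarrow> (\<forall>\<nu>. radon_on betaM \<nu> \<and> preceq \<nu> \<mu> \<longrightarrow> preceq \<mu> \<nu>)"

end

theory Submission
  imports Defs
begin

text \<open>
  The function \<open>g0 = 1 / (1 + d)\<close> lies in \<open>G\<close>, and by strict concavity of \<open>t / (1 + t)\<close> the metric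
  \<open>c0 = d * g0\<close> satisfies the triangle inequality with room to spare along genuine detours.
  Minimality of \<open>\<mu>\<close> yields, for every \<open>e > 0\<close>, some \<open>h \<in> G\<close> with \<open>h \<ge> - g0\<close> and
  \<open>\<integral>h + g0 d\<mu> < e\<close>. Suppose that \<open>\<Phi>\<^sup>*\<mu>\<close> vanishes on the functions that vanish on \<open>A\<close>, while a
  coordinate of some point of the support of \<open>\<mu>\<close> stays away from \<open>A\<close>. Regard \<open>c + c0\<close>, where
  \<open>c = d * h\<close>, as the cost of a step. Because \<open>c \<ge> - c0\<close> obeys the triangle inequality, a path that
  joins two points of \<open>A\<close> through a region \<open>U\<close> away from \<open>A\<close> still has nonnegative cost when a
  fraction \<open>b\<close> of \<open>c0\<close> is deducted on the steps touching \<open>U\<close>, with \<open>b\<close> independent of \<open>h\<close>. The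
  shortest-path potential \<open>u\<close> of the reduced cost is Lipschitz and vanishes on \<open>A\<close>, and
  \<open>h + g0 + \<Phi> u \<ge> 0\<close> everywhere, with at least \<open>b * g0\<close> on the part of the compactification lying
  over \<open>U\<close>. Integrating, \<open>\<Phi> u\<close> contributes nothing, so that \<open>e\<close> is bounded below by a positive
  constant, because \<open>g0 > 0\<close> wherever \<open>d\<close> is finite.
\<close>

section \<open>Sublinear functionals\<close>

text \<open>Homogeneity is asked only as an inequality for positive factors; using it for both
  \<open>c\<close> and \<open>inverse c\<close> gives equality, and then the value 0 at the zero
  function.\<close>

definition sublinear_on :: "('b \<Rightarrow> real) set \<Rightarrow> (('b \<Rightarrow> real) \<Rightarrow> real) \<Rightarrow> bool" where
  "sublinear_on V p \<longleftrightarrow>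
     (\<forall>f\<in>V. \<forall>g\<in>V. p (\<lambda>x. f x + g x) \<le> p f + p g) \<and>
     (\<forall>f\<in>V. \<forall>c>0. p (\<lambda>x. c * f x) \<le> c * p f)"

definition linear_functional_on :: "('b \<Rightarrow> real) set \<Rightarrow> (('b \<Rightarrow> real) \<Rightarrow> real) \<Rightarrow> bool" where
  "linear_functional_on V L \<longleftrightarrow>
     (\<forall>f\<in>V. \<forall>g\<in>V. L (\<lambda>x. f x + g x) = L f + L g) \<and>
     (\<forall>f\<in>V. \<forall>c. L (\<lambda>x. c * f x) = c * L f)"

locale function_subspace =
  fixes V :: "('b \<Rightarrow> real) set"
  assumes zero_mem: "(\<lambda>x. 0) \<in> V"
    and add_mem: "\<And>f g. f \<in> V \<Longrightarrow> g \<in> V \<Longrightarrow> (\<lambda>x. f x + g x) \<in> V"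
    and scale_mem: "\<And>f c. f \<in> V \<Longrightarrow> (\<lambda>x. c * f x) \<in> V"
begin

lemma uminus_mem: "f \<in> V \<Longrightarrow> (\<lambda>x. - f x) \<in> V"
  using scale_mem[of f "-1"] by simp

lemma sublinear_add:
  "sublinear_on V p \<Longrightarrow> f \<in> V \<Longrightarrow> g \<in> V \<Longrightarrow> p (\<lambda>x. f x + g x) \<le> p f + p g"
  by (simp add: sublinear_on_def)

lemma sublinear_scale:
  assumes "sublinear_on V p" "f \<in> V" "c > 0"
  shows "p (\<lambda>x. c * f x) = c * p f"
proof -
  have "p (\<lambda>x. inverse c * (c * f x)) \<le> inverse c * p (\<lambda>x. c * f x)"
    using assms scale_mem[of f c] by (simp only: sublinear_on_def) simp
  then have "c * p f \<le> p (\<lambda>x. c * f x)"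
    using assms(3) by (simp add: field_simps)
  moreover have "p (\<lambda>x. c * f x) \<le> c * p f"
    using assms by (simp add: sublinear_on_def)
  ultimately show ?thesis by simp
qed

lemma sublinear_zero: "sublinear_on V p \<Longrightarrow> p (\<lambda>x. 0) = 0"
  using sublinear_scale[of p "\<lambda>x. 0" 2] zero_mem by simp

lemma sublinear_lower:
  assumes "sublinear_on V p" "f \<in> V"
  shows "- p (\<lambda>x. - f x) \<le> p f"
  using sublinear_add[OF assms(1) assms(2) uminus_mem[OF assms(2)]] sublinear_zero[OF assms(1)]
  by simp

text \<open>The witness is \<open>q f = inf {p (f + t y) - t p y | t >= 0}\<close>. The parameter
  \<open>t = 0\<close> puts it below \<open>p\<close>, and \<open>t = 1\<close> yields the other two
  bounds. It is the device that turns minimality into additivity.\<close>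

lemma sublinear_directional:
  assumes p: "sublinear_on V p" and y: "y \<in> V"
  obtains q where "sublinear_on V q" "\<forall>f\<in>V. q f \<le> p f" "q (\<lambda>x. - y x) \<le> - p y"
    "\<forall>f\<in>V. q f \<le> p (\<lambda>x. f x + y x) - p y"
proof
  define I where "I f = (\<lambda>t. p (\<lambda>x. f x + t * y x) - t * p y) ` {0..}" for f
  define q where "q f = Inf (I f)" for f
  have ne: "I f \<noteq> {}" for f by (auto simp: I_def)
  have bdd: "bdd_below (I f)" if f: "f \<in> V" for f
  proof (rule bdd_belowI)
    fix r assume "r \<in> I f"
    then obtain t where t: "t \<ge> 0" "r = p (\<lambda>x. f x + t * y x) - t * p y" by (auto simp: I_def)
    \<comment> \<open>Writing \<open>t y\<close> as \<open>(f + t y) - f\<close> makes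
      \<open>- p (- f)\<close> a lower bound for every \<open>t\<close>.\<close>
    have "p (\<lambda>x. (f x + t * y x) + - f x) \<le> p (\<lambda>x. f x + t * y x) + p (\<lambda>x. - f x)"
      using sublinear_add[OF p add_mem[OF f scale_mem[OF y]] uminus_mem[OF f]] .
    moreover have "p (\<lambda>x. t * y x) = t * p y"
      using sublinear_scale[OF p y, of t] sublinear_zero[OF p] t(1) by (cases "t = 0") auto
    ultimately show "- p (\<lambda>x. - f x) \<le> r" using t(2) by simp
  qed
  have le: "q f \<le> p (\<lambda>x. f x + t * y x) - t * p y" if "f \<in> V" "t \<ge> 0" for f t
    unfolding q_def by (rule cInf_lower[OF _ bdd[OF that(1)]]) (use that in \<open>auto simp: I_def\<close>)
  have approx: "\<exists>t\<ge>0. p (\<lambda>x. f x + t * y x) - t * p y < q f + e" if "f \<in> V" "e > 0" for f e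
    using cInf_lessD[OF ne, of f "q f + e"] that by (auto simp: I_def q_def)
  show "sublinear_on V q"
    unfolding sublinear_on_def
  proof (intro conjI ballI allI impI)
    fix f g assume f: "f \<in> V" and g: "g \<in> V"
    show "q (\<lambda>x. f x + g x) \<le> q f + q g"
    proof (rule field_le_epsilon)
      fix e :: real assume "e > 0"
      obtain t where t: "t \<ge> 0" "p (\<lambda>x. f x + t * y x) - t * p y < q f + e/2"
        using approx[OF f, of "e/2"] \<open>e > 0\<close> by auto
      obtain s where s: "s \<ge> 0" "p (\<lambda>x. g x + s * y x) - s * p y < q g + e/2"
        using approx[OF g, of "e/2"] \<open>e > 0\<close> by auto
      have "q (\<lambda>x. f x + g x) \<le> p (\<lambda>x. (f x + g x) + (t + s) * y x) - (t + s) * p y"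
        using le[OF add_mem[OF f g], of "t + s"] t s by simp
      also have "(\<lambda>x. (f x + g x) + (t + s) * y x) = (\<lambda>x. (f x + t * y x) + (g x + s * y x))"
        by (auto simp: algebra_simps)
      also have "p \<dots> \<le> p (\<lambda>x. f x + t * y x) + p (\<lambda>x. g x + s * y x)"
        by (intro sublinear_add p add_mem scale_mem f g y)
      finally show "q (\<lambda>x. f x + g x) \<le> q f + q g + e"
        using t s by (simp add: algebra_simps)
    qed
  next
    fix f and c :: real assume f: "f \<in> V" and c: "c > 0"
    show "q (\<lambda>x. c * f x) \<le> c * q f"
    proof (rule field_le_epsilon)
      fix e :: real assume "e > 0"
      obtain t where t: "t \<ge> 0" "p (\<lambda>x. f x + t * y x) - t * p y < q f + e/c"
        using approx[OF f, of "e/c"] \<open>e > 0\<close> c by auto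
      have "q (\<lambda>x. c * f x) \<le> p (\<lambda>x. c * f x + (c * t) * y x) - (c * t) * p y"
        using le[OF scale_mem[OF f], of "c * t"] t c by simp
      also have "(\<lambda>x. c * f x + (c * t) * y x) = (\<lambda>x. c * (f x + t * y x))"
        by (auto simp: algebra_simps)
      also have "p \<dots> = c * p (\<lambda>x. f x + t * y x)"
        by (intro sublinear_scale p add_mem scale_mem f y c)
      also have "c * p (\<lambda>x. f x + t * y x) - c * t * p y = c * (p (\<lambda>x. f x + t * y x) - t * p y)"
        by (simp add: algebra_simps)
      also have "\<dots> \<le> c * (q f + e/c)"
        using t(2) c by (intro mult_left_mono) auto
      also have "\<dots> = c * q f + e" using c by (simp add: distrib_left)
      finally show "q (\<lambda>x. c * f x) \<le> c * q f + e" .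
    qed
  qed
  show "\<forall>f\<in>V. q f \<le> p f" using le[of _ 0] by simp
  show "q (\<lambda>x. - y x) \<le> - p y"
    using le[OF uminus_mem[OF y], of 1] sublinear_zero[OF p] by simp
  show "\<forall>f\<in>V. q f \<le> p (\<lambda>x. f x + y x) - p y" using le[of _ 1] by simp
qed

text \<open>Zorn's lemma on the functionals below \<open>p\<close>. A chain is bounded below at
  \<open>f\<close> by \<open>- p (- f)\<close>, and its pointwise infimum is again
  sublinear.\<close>

lemma minimal_sublinear_exists:
  assumes p: "sublinear_on V p"
  obtains m where "sublinear_on V m" "\<forall>f\<in>V. m f \<le> p f"
    "\<forall>q. sublinear_on V q \<longrightarrow> (\<forall>f\<in>V. q f \<le> m f) \<longrightarrow> (\<forall>f\<in>V. q f = m f)"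
proof -
  \<comment> \<open>Fixing the value 0 outside \<open>V\<close> makes comparison on \<open>V\<close>
    antisymmetric.\<close>
  define A where "A = {q. sublinear_on V q \<and> (\<forall>f\<in>V. q f \<le> p f) \<and> (\<forall>f. f \<notin> V \<longrightarrow> q f = 0)}"
  \<comment> \<open>The order is reversed, so that a maximal element for \<open>P\<close> is a
    minimal functional.\<close>
  define P where "P q r \<longleftrightarrow> (\<forall>f\<in>V. r f \<le> q f)" for q r :: "('b \<Rightarrow> real) \<Rightarrow> real"
  have restr: "sublinear_on V (\<lambda>f. if f \<in> V then q f else 0) \<longleftrightarrow> sublinear_on V q" for q
    unfolding sublinear_on_def by (simp add: add_mem scale_mem)
  have "\<exists>m\<in>A. \<forall>a\<in>A. P m a \<longrightarrow> a = m"
  proof (rule predicate_Zorn)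
    show "partial_order_on A (relation_of P A)"
    proof (rule partial_order_on_relation_ofI)
      show "P q q" for q by (simp add: P_def)
      show "P q s" if "P q r" "P r s" for q r s using that by (force simp: P_def)
      show "q = r" if "q \<in> A" "r \<in> A" "P q r" "P r q" for q r
      proof
        show "q f = r f" for f using that by (cases "f \<in> V") (auto simp: P_def A_def intro: order_antisym)
      qed
    qed
    fix C assume "C \<in> Chains (relation_of P A)"
    then have CA: "C \<subseteq> A" and cmp: "\<And>q r. q \<in> C \<Longrightarrow> r \<in> C \<Longrightarrow> P q r \<or> P r q"
      by (auto simp: Chains_def relation_of_def)
    show "\<exists>u\<in>A. \<forall>a\<in>C. P a u"
    proof (cases "C = {}")
      case True
      have "(\<lambda>f. if f \<in> V then p f else 0) \<in> A" using p by (simp add: A_def restr)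
      then show ?thesis using True by blast
    next
      case False
      define r where "r f = (INF q\<in>C. q f)" for f
      have bdd: "bdd_below ((\<lambda>q. q f) ` C)" if f: "f \<in> V" for f
      proof (rule bdd_belowI2)
        fix q assume "q \<in> C"
        then have "sublinear_on V q" "q (\<lambda>x. - f x) \<le> p (\<lambda>x. - f x)"
          using CA uminus_mem[OF f] by (auto simp: A_def)
        then show "- p (\<lambda>x. - f x) \<le> q f" using sublinear_lower[of q f] f by simp
      qed
      have le: "r f \<le> q f" if "f \<in> V" "q \<in> C" for f q
        unfolding r_def by (rule cINF_lower[OF bdd]) (use that in auto)
      have approx: "\<exists>q\<in>C. q f < r f + e" if "f \<in> V" "e > 0" for f e
        using cInf_lessD[of "(\<lambda>q. q f) ` C" "r f + e"] that False by (auto simp: r_def)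
      have "sublinear_on V r"
        unfolding sublinear_on_def
      proof (intro conjI ballI allI impI)
        fix f g assume f: "f \<in> V" and g: "g \<in> V"
        show "r (\<lambda>x. f x + g x) \<le> r f + r g"
        proof (rule field_le_epsilon)
          fix e :: real assume "e > 0"
          obtain q1 q2 where q: "q1 \<in> C" "q1 f < r f + e/2" "q2 \<in> C" "q2 g < r g + e/2"
            using approx[OF f, of "e/2"] approx[OF g, of "e/2"] \<open>e > 0\<close> by auto
          obtain q where "q \<in> C" "q f \<le> q1 f" "q g \<le> q2 g"
            using cmp[OF q(1) q(3)] q(1,3) f g unfolding P_def by blast
          then show "r (\<lambda>x. f x + g x) \<le> r f + r g + e"
            using le[OF add_mem[OF f g], of q] sublinear_add[of q f g] f g CA q
            by (force simp: A_def)
        qed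
      next
        fix f and c :: real assume f: "f \<in> V" and c: "c > 0"
        show "r (\<lambda>x. c * f x) \<le> c * r f"
        proof (rule field_le_epsilon)
          fix e :: real assume "e > 0"
          obtain q where q: "q \<in> C" "q f < r f + e/c"
            using approx[OF f, of "e/c"] \<open>e > 0\<close> c by auto
          have "r (\<lambda>x. c * f x) \<le> c * q f"
            using le[OF scale_mem[OF f] q(1), of c] sublinear_scale[of q f c] f CA q c
            by (fastforce simp: A_def)
          also have "\<dots> \<le> c * (r f + e/c)" using q(2) c by (intro mult_left_mono) auto
          also have "\<dots> = c * r f + e" using c by (simp add: distrib_left)
          finally show "r (\<lambda>x. c * f x) \<le> c * r f + e" .
        qed
      qed
      moreover have "\<forall>f\<in>V. r f \<le> p f"
      proof
        fix f assume f: "f \<in> V"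
        obtain q where q: "q \<in> C" using False by blast
        then have "q f \<le> p f" using CA f by (auto simp: A_def)
        then show "r f \<le> p f" using le[OF f q] by simp
      qed
      ultimately have "(\<lambda>f. if f \<in> V then r f else 0) \<in> A" by (simp add: A_def restr)
      moreover have "\<forall>a\<in>C. P a (\<lambda>f. if f \<in> V then r f else 0)" using le by (simp add: P_def)
      ultimately show ?thesis by blast
    qed
  qed
  then obtain m where m: "m \<in> A" "\<And>a. a \<in> A \<Longrightarrow> P m a \<Longrightarrow> a = m" by blast
  show thesis
  proof
    show "sublinear_on V m" "\<forall>f\<in>V. m f \<le> p f" using m(1) by (auto simp: A_def)
    show "\<forall>q. sublinear_on V q \<longrightarrow> (\<forall>f\<in>V. q f \<le> m f) \<longrightarrow> (\<forall>f\<in>V. q f = m f)"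
    proof (intro allI impI)
      fix q assume q: "sublinear_on V q" "\<forall>f\<in>V. q f \<le> m f"
      then have "(\<lambda>f. if f \<in> V then q f else 0) \<in> A"
        using m(1) by (force simp: A_def restr)
      then have "(\<lambda>f. if f \<in> V then q f else 0) = m"
        using m(2) q(2) by (simp add: P_def)
      then show "\<forall>f\<in>V. q f = m f" by auto
    qed
  qed
qed

text \<open>A minimal sublinear functional is already linear, so no extension from subspaces is needed.\<close>

theorem Hahn_Banach:
  assumes p: "sublinear_on V p" and y: "y \<in> V"
  obtains L where "linear_functional_on V L" "\<forall>f\<in>V. L f \<le> p f" "L y = p y"
proof -
  \<comment> \<open>Every linear \<open>L\<close> below \<open>p'\<close> satisfies
    \<open>L (- y) <= - p y\<close>, that is \<open>L y >= p y\<close>; so touching \<open>p\<close>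
    at \<open>y\<close> survives the passage to a minimal functional.\<close>
  obtain p' where p': "sublinear_on V p'" "\<forall>f\<in>V. p' f \<le> p f" "p' (\<lambda>x. - y x) \<le> - p y"
    by (rule sublinear_directional[OF p y], rule that)
  obtain m where m: "sublinear_on V m" "\<forall>f\<in>V. m f \<le> p' f"
    "\<forall>q. sublinear_on V q \<longrightarrow> (\<forall>f\<in>V. q f \<le> m f) \<longrightarrow> (\<forall>f\<in>V. q f = m f)"
    by (rule minimal_sublinear_exists[OF p'(1)], rule that)
  have add: "m (\<lambda>x. f x + g x) = m f + m g" if f: "f \<in> V" and g: "g \<in> V" for f g
  proof -
    \<comment> \<open>The directional functional of \<open>m\<close> along \<open>g\<close> lies
      below \<open>m\<close>, so minimality makes them equal; its bound at \<open>f\<close> is then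
      the superadditivity of \<open>m\<close>.\<close>
    obtain q where q: "sublinear_on V q" "\<forall>f\<in>V. q f \<le> m f"
      "\<forall>f\<in>V. q f \<le> m (\<lambda>x. f x + g x) - m g"
      by (rule sublinear_directional[OF m(1) g], rule that)
    have "q f = m f" using m(3) q(1,2) f by blast
    then have "m f \<le> m (\<lambda>x. f x + g x) - m g" using q(3) f by auto
    then show ?thesis using sublinear_add[OF m(1) f g] by simp
  qed
  have neg: "m (\<lambda>x. - f x) = - m f" if f: "f \<in> V" for f
    using add[OF f uminus_mem[OF f]] sublinear_zero[OF m(1)] by simp
  have scale: "m (\<lambda>x. c * f x) = c * m f" if f: "f \<in> V" for f c
  proof -
    consider "c > 0" | "c = 0" | "c < 0" by linarith
    then show ?thesis
    proof cases
      case 3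
      then have "m (\<lambda>x. - ((- c) * f x)) = - (- c * m f)"
        using neg[OF scale_mem[OF f, of "- c"]] sublinear_scale[OF m(1) f, of "- c"] by linarith
      then show ?thesis by simp
    qed (use sublinear_scale[OF m(1) f] sublinear_zero[OF m(1)] in auto)
  qed
  show thesis
  proof
    show "linear_functional_on V m" by (simp add: linear_functional_on_def add scale)
    show "\<forall>f\<in>V. m f \<le> p f" using m(2) p'(2) by force
    moreover have "p y \<le> m y"
      using bspec[OF m(2) uminus_mem[OF y]] p'(3) neg[OF y] by linarith
    ultimately show "m y = p y" using y by (simp add: order_antisym)
  qed
qed

end

section \<open>Positive functionals on compact spaces\<close>

text \<open>The compact Hausdorff subspace \<open>K\<close> is normal, so a Urysohn function
  separates the point from the relatively closed set \<open>K - U\<close>.\<close>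

lemma compact_Urysohn_point:
  fixes K :: "'b::topological_space set"
  assumes K: "compact K" "Hausdorff_space (top_of_set K)" and U: "open U" and x: "x \<in> K" "x \<in> U"
  obtains g :: "'b \<Rightarrow> real" where "continuous_on K g" "\<And>y. y \<in> K \<Longrightarrow> 0 \<le> g y \<and> g y \<le> 1"
    "g x = 1" "\<And>y. y \<in> K - U \<Longrightarrow> g y = 0"
proof -
  have "normal_space (top_of_set K)"
    using K by (intro compact_Hausdorff_or_regular_imp_normal_space) (simp_all add: compact_space_subtopology)
  moreover have "closedin (top_of_set K) (K - U)"
    using U unfolding closedin_closed Diff_eq by (blast intro: closed_Compl)
  moreover have "closedin (top_of_set K) {x}"
    using closedin_Hausdorff_singleton[OF K(2)] x by simp
  ultimately obtain g where g: "continuous_map (top_of_set K) (top_of_set {0..1::real}) g"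
    "g ` (K - U) \<subseteq> {0}" "g ` {x} \<subseteq> {1}"
    using Urysohn_lemma[of "top_of_set K" "K - U" "{x}" 0 1] x by (auto simp: disjnt_def)
  then show ?thesis
    by (intro that[of g]) (auto simp: continuous_map_in_subtopology Pi_def image_subset_iff)
qed

lemma radon_integrable:
  fixes f :: "'b::topological_space \<Rightarrow> real"
  assumes S: "compact S" and \<mu>: "radon_on S \<mu>" and f: "continuous_on S f"
  shows "integrable \<mu> f"
proof -
  interpret finite_measure \<mu> using \<mu> by (simp add: radon_on_def)
  obtain B where B: "\<And>x. x \<in> S \<Longrightarrow> norm (f x) \<le> B"
    using compact_imp_bounded[OF compact_continuous_image[OF f S]] unfolding bounded_iff by auto
  have "f \<in> borel_measurable (restrict_space borel S)"
    by (rule borel_measurable_continuous_on_restrict[OF f])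
  moreover have "sets \<mu> = sets (restrict_space borel S)" "space \<mu> = S"
    using \<mu> by (auto simp: radon_on_def)
  ultimately show ?thesis
    by (intro integrable_const_bound[where B = B]) (use B in \<open>auto cong: measurable_cong_sets\<close>)
qed

text \<open>Functions are total, but \<open>mono\<close> shows that only their values on
  \<open>K\<close> influence \<open>L\<close>. \<open>closed\<close> is listed beside
  \<open>compact\<close> because the ambient type carries no separation axiom.\<close>

locale positive_functional =
  fixes K :: "'b::topological_space set" and L :: "('b \<Rightarrow> real) \<Rightarrow> real"
  assumes compact: "compact K" and closed: "closed K" and Hausdorff: "Hausdorff_space (top_of_set K)"
    and add: "\<And>f g. continuous_on K f \<Longrightarrow> continuous_on K g \<Longrightarrow> L (\<lambda>x. f x + g x) = L f + L g"
    and scale: "\<And>f c. continuous_on K f \<Longrightarrow> L (\<lambda>x. c * f x) = c * L f"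
    and nonneg: "\<And>f. continuous_on K f \<Longrightarrow> (\<And>x. x \<in> K \<Longrightarrow> 0 \<le> f x) \<Longrightarrow> 0 \<le> L f"
begin

lemma zero: "L (\<lambda>x. 0) = 0"
  using scale[of "\<lambda>x. 0" 0] by simp

lemma mono:
  assumes f: "continuous_on K f" and g: "continuous_on K g" and le: "\<And>x. x \<in> K \<Longrightarrow> f x \<le> g x"
  shows "L f \<le> L g"
proof -
  have "0 \<le> L (\<lambda>x. g x + (- 1) * f x)"
    by (rule nonneg) (use f g le in \<open>auto intro!: continuous_intros\<close>)
  also have "\<dots> = L g + (- 1) * L f"
    using f g by (subst add) (auto simp: scale[of f "-1", simplified] intro!: continuous_intros)
  finally show ?thesis by simp
qed

lemma sum:
  "finite I \<Longrightarrow> (\<And>i. i \<in> I \<Longrightarrow> continuous_on K (f i)) \<Longrightarrow> L (\<lambda>x. \<Sum>i\<in>I. f i x) = (\<Sum>i\<in>I. L (f i))"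
  by (induction rule: finite_induct) (simp_all add: zero add continuous_on_sum)

section \<open>Content and outer measure of a positive functional\<close>

definition below :: "'b set \<Rightarrow> ('b \<Rightarrow> real) set" where
  "below U = {f. continuous_on K f \<and> (\<forall>x\<in>K. 0 \<le> f x \<and> f x \<le> 1) \<and> (\<forall>x\<in>K - U. f x = 0)}"

definition content :: "'b set \<Rightarrow> ennreal" where
  "content U = (SUP f \<in> below U. ennreal (L f))"

definition outer :: "'b set \<Rightarrow> ennreal" where
  "outer E = (INF U \<in> {U. open U \<and> E \<subseteq> U}. content U)"

lemma zero_below: "(\<lambda>x. 0) \<in> below U"
  by (simp add: below_def)

lemma below_nonneg: "f \<in> below U \<Longrightarrow> 0 \<le> L f"
  by (rule nonneg) (auto simp: below_def)

lemma content_upper: "f \<in> below U \<Longrightarrow> ennreal (L f) \<le> content U"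
  unfolding content_def by (rule SUP_upper)

lemma content_mono: "K \<inter> U \<subseteq> V \<Longrightarrow> content U \<le> content V"
  unfolding content_def by (rule SUP_subset_mono) (auto simp: below_def)

lemma content_empty: "content {} = 0"
proof -
  have "L f \<le> 0" if "f \<in> below {}" for f
    using mono[of f "\<lambda>x. 0"] that zero by (auto simp: below_def)
  then show ?thesis by (auto simp: content_def ennreal_neg intro!: SUP_eq_const exI[of _ "\<lambda>x. 0"] zero_below)
qed

lemma content_le_total: "content U \<le> ennreal (L (\<lambda>x. 1))"
  unfolding content_def
  by (rule SUP_least, rule ennreal_leI, rule mono) (auto simp: below_def)

lemma outer_open: "open U \<Longrightarrow> outer U = content U"
  unfolding outer_def by (rule antisym) (auto intro!: INF_lower INF_greatest content_mono)

lemma outer_mono: "A \<subseteq> B \<Longrightarrow> outer A \<le> outer B"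
  unfolding outer_def by (rule INF_superset_mono) auto

lemma outer_empty: "outer {} = 0"
  by (simp add: outer_open content_empty)

lemma outer_le_total: "outer E \<le> ennreal (L (\<lambda>x. 1))"
  unfolding outer_def by (rule INF_lower2[of UNIV]) (auto intro: content_le_total)

lemma outer_approx:
  assumes "0 < e"
  obtains U where "open U" "E \<subseteq> U" "content U < outer E + ennreal e"
proof -
  have "outer E < top" using outer_le_total[of E] by (simp add: le_less_trans)
  then have "outer E < outer E + ennreal e" using assms ennreal_add_left_cancel_less[of "outer E" 0 "ennreal e"] by (auto simp: ennreal_less_zero_iff)
  then show ?thesis using that unfolding outer_def by (auto simp: INF_less_iff)
qed

text \<open>Cutting off at height \<open>e\<close> makes the support of a function in \<open>below U\<close> a compact
  subset of \<open>U\<close>, at the cost of at most \<open>e * L 1\<close>.\<close>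

lemma cutoff:
  assumes f: "f \<in> below U" and e: "0 < e"
  shows "(\<lambda>x. max 0 (f x - e)) \<in> below U" "L f \<le> L (\<lambda>x. max 0 (f x - e)) + e * L (\<lambda>x. 1)"
proof -
  have c: "continuous_on K f" using f by (simp add: below_def)
  show "(\<lambda>x. max 0 (f x - e)) \<in> below U"
    using f e by (force simp: below_def intro!: continuous_intros)
  have "L f \<le> L (\<lambda>x. max 0 (f x - e) + e * 1)"
    by (rule mono) (auto intro!: continuous_intros c)
  also have "\<dots> = L (\<lambda>x. max 0 (f x - e)) + L (\<lambda>x. e * 1)"
    by (rule add) (auto intro!: continuous_intros c)
  also have "L (\<lambda>x. e * 1) = e * L (\<lambda>x. 1)" by (rule scale) simp
  finally show "L f \<le> L (\<lambda>x. max 0 (f x - e)) + e * L (\<lambda>x. 1)" .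
qed

lemma closed_level:
  assumes f: "f \<in> below U" shows "closed {x\<in>K. e \<le> f x}"
proof -
  have "closedin (top_of_set K) (K \<inter> f -` {e..})"
    using f by (intro continuous_closedin_preimage) (auto simp: below_def)
  moreover have "K \<inter> f -` {e..} = {x\<in>K. e \<le> f x}" by auto
  ultimately show ?thesis using closedin_closed_trans[OF _ closed] by metis
qed

lemma compact_level: "f \<in> below U \<Longrightarrow> compact {x\<in>K. e \<le> f x}"
  using compact_Int_closed[OF compact closed_level[of f U e]] by (simp add: Int_def conj_commute cong: conj_cong)

text \<open>A partition of unity: the truncated \<open>f\<close> lives on a compact level set
  covered by finitely many bumps, each vanishing outside one \<open>U n\<close>. Splitting it in
  proportion to the bumps and collecting the pieces by index gives one competitor for each
  \<open>content (U m)\<close>.\<close>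

lemma content_le_sum:
  fixes U :: "nat \<Rightarrow> 'b set"
  assumes op: "\<And>n. open (U n)"
  shows "content (\<Union>n. U n) \<le> (\<Sum>n. content (U n))"
  unfolding content_def[of "\<Union>n. U n"]
proof (rule SUP_least)
  fix f assume f: "f \<in> below (\<Union>n. U n)"
  have cf: "continuous_on K f" using f by (simp add: below_def)
  show "ennreal (L f) \<le> (\<Sum>n. content (U n))"
  proof (rule ennreal_le_epsilon)
    fix d :: real assume "d > 0"
    \<comment> \<open>The truncation then costs at most \<open>d\<close>; the added 1 covers the
      case \<open>L 1 = 0\<close>.\<close>
    define e where "e = d / (L (\<lambda>x. 1) + 1)"
    have L1: "L (\<lambda>x. 1) \<ge> 0" by (rule nonneg) auto
    have e: "e > 0" "e * L (\<lambda>x. 1) \<le> d" using \<open>d > 0\<close> L1 by (auto simp: e_def field_simps)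
    let ?f = "\<lambda>x. max 0 (f x - e)" and ?C = "{x\<in>K. e \<le> f x}"
    have "\<exists>n g. continuous_on K g \<and> (\<forall>y\<in>K. 0 \<le> g y \<and> g y \<le> 1) \<and> g x = 1 \<and> (\<forall>y\<in>K - U n. g y = (0::real))"
      if x: "x \<in> ?C" for x
    proof -
      have "x \<in> (\<Union>n. U n)" using x f e(1) by (force simp: below_def)
      then obtain n where n: "x \<in> U n" by blast
      obtain g where "continuous_on K g" "\<And>y. y \<in> K \<Longrightarrow> 0 \<le> g y \<and> g y \<le> (1::real)"
        "g x = 1" "\<And>y. y \<in> K - U n \<Longrightarrow> g y = 0"
        using compact_Urysohn_point[OF compact Hausdorff op[of n], of x] n x by blast
      then show ?thesis by blast
    qed
    then obtain n where "\<forall>x\<in>?C. \<exists>g. continuous_on K g \<and> (\<forall>y\<in>K. 0 \<le> g y \<and> g y \<le> 1) \<and>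
        g x = 1 \<and> (\<forall>y\<in>K - U (n x). g y = (0::real))"
      using bchoice[of ?C "\<lambda>x n. \<exists>g. continuous_on K g \<and> (\<forall>y\<in>K. 0 \<le> g y \<and> g y \<le> 1) \<and>
        g x = 1 \<and> (\<forall>y\<in>K - U n. g y = (0::real))"] by blast
    from bchoice[OF this] obtain g where
      "\<forall>x\<in>?C. continuous_on K (g x) \<and> (\<forall>y\<in>K. 0 \<le> g x y \<and> g x y \<le> 1) \<and>
        g x x = 1 \<and> (\<forall>y\<in>K - U (n x). g x y = (0::real))" ..
    then have g: "\<And>x. x \<in> ?C \<Longrightarrow> continuous_on K (g x)"
      "\<And>x y. x \<in> ?C \<Longrightarrow> y \<in> K \<Longrightarrow> 0 \<le> g x y \<and> g x y \<le> 1"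
      "\<And>x. x \<in> ?C \<Longrightarrow> g x x = 1" "\<And>x y. x \<in> ?C \<Longrightarrow> y \<in> K - U (n x) \<Longrightarrow> g x y = (0::real)"
      by simp_all
    have "\<exists>V. open V \<and> V \<inter> K = {y\<in>K. 1/2 < g x y}" if "x \<in> ?C" for x
    proof -
      have "openin (top_of_set K) (K \<inter> g x -` {1/2<..})"
        by (rule continuous_openin_preimage_gen[OF g(1)[OF that]]) simp
      moreover have "K \<inter> g x -` {1/2<..} = {y\<in>K. 1/2 < g x y}" by auto
      ultimately show ?thesis by (auto simp: openin_open inf_commute)
    qed
    then have "\<forall>x\<in>?C. \<exists>V. open V \<and> V \<inter> K = {y\<in>K. 1/2 < g x y}" by blast
    from bchoice[OF this] obtain V where V: "\<And>x. x \<in> ?C \<Longrightarrow> open (V x)"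
      "\<And>x. x \<in> ?C \<Longrightarrow> V x \<inter> K = {y\<in>K. 1/2 < g x y}"
      by blast
    have "?C \<subseteq> (\<Union>x\<in>?C. V x)" using V(2) g(3) by fastforce
    then obtain T where T: "T \<subseteq> ?C" "finite T" "?C \<subseteq> (\<Union>x\<in>T. V x)"
      using compactE_image[OF compact_level[OF f, of e], of ?C V] V(1) by blast
    define G where "G y = (\<Sum>x\<in>T. g x y)" for y
    have G: "1/2 < G y" if "y \<in> ?C" for y
    proof -
      obtain x where x: "x \<in> T" "y \<in> V x" using T(3) \<open>y \<in> ?C\<close> by blast
      then have "1/2 < g x y" using V(2)[of x] T(1) \<open>y \<in> ?C\<close> by auto
      also have "\<dots> \<le> G y" unfolding G_def
        by (rule member_le_sum) (use x T g(2) that in auto)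
      finally show ?thesis .
    qed
    \<comment> \<open>On the level set the maximum is \<open>G\<close> itself; elsewhere
      \<open>?f\<close> is 0, and the maximum only keeps the quotient continuous.\<close>
    define h where "h x y = ?f y * g x y / max (G y) (1/2)" for x y
    have cG: "continuous_on K G" unfolding G_def using T(1) by (intro continuous_on_sum g(1)) auto
    have ch: "continuous_on K (h x)" if "x \<in> T" for x
      unfolding h_def using T(1) that
      by (intro continuous_intros cf cG g(1)) auto
    have hs: "(\<Sum>x\<in>T. h x y) = ?f y" if "y \<in> K" for y
    proof (cases "y \<in> ?C")
      case True
      have "(\<Sum>x\<in>T. h x y) = ?f y * G y / max (G y) (1/2)"
        by (simp add: h_def G_def sum_distrib_left sum_divide_distrib)
      then show ?thesis using G[OF True] by simp
    next
      case False
      then show ?thesis using that by (simp add: h_def)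
    qed
    have h0: "0 \<le> h x y" if "x \<in> T" "y \<in> K" for x y
      unfolding h_def using g(2)[of x y] T(1) that by (intro divide_nonneg_nonneg mult_nonneg_nonneg) auto
    \<comment> \<open>Several bumps may belong to the same index; their pieces together are still
      bounded by \<open>?f\<close>, hence by 1.\<close>
    define k where "k m y = (\<Sum>x\<in>{x\<in>T. n x = m}. h x y)" for m y
    have kb: "k m \<in> below (U m)" for m
      unfolding below_def
    proof (intro CollectI conjI ballI)
      show "continuous_on K (k m)" unfolding k_def by (intro continuous_on_sum ch) auto
      fix y assume y: "y \<in> K"
      show "0 \<le> k m y" unfolding k_def by (intro sum_nonneg h0) (use y in auto)
      have "k m y \<le> (\<Sum>x\<in>T. h x y)" unfolding k_def
        by (rule sum_mono2) (use T(2) h0 y in auto)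
      also have "\<dots> \<le> 1" using hs[OF y] cutoff(1)[OF f e(1)] y by (simp add: below_def)
      finally show "k m y \<le> 1" .
    next
      fix y assume "y \<in> K - U m"
      then show "k m y = 0" unfolding k_def using g(4) T(1) by (intro sum.neutral) (auto simp: h_def)
    qed
    have "L ?f \<le> L (\<lambda>y. \<Sum>x\<in>T. h x y)"
      using hs by (intro mono) (auto intro!: continuous_intros cf ch)
    also have "(\<lambda>y. \<Sum>x\<in>T. h x y) = (\<lambda>y. \<Sum>m\<in>n ` T. k m y)"
      unfolding k_def by (intro ext sum.image_gen T(2))
    also have "L \<dots> = (\<Sum>m\<in>n ` T. L (k m))"
      using T(2) kb by (intro sum) (auto simp: below_def)
    finally have "ennreal (L ?f) \<le> (\<Sum>m\<in>n ` T. ennreal (L (k m)))"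
      using below_nonneg[OF kb] by (subst sum_ennreal) (auto intro: ennreal_leI)
    also have "\<dots> \<le> (\<Sum>m\<in>n ` T. content (U m))" by (intro sum_mono content_upper kb)
    also have "\<dots> \<le> (\<Sum>m. content (U m))" using T(2) by (intro sum_le_suminf) auto
    finally have 1: "ennreal (L ?f) \<le> (\<Sum>m. content (U m))" .
    have "ennreal (L f) \<le> ennreal (L ?f + d)"
      using cutoff(2)[OF f e(1)] e(2) by (intro ennreal_leI) linarith
    also have "\<dots> = ennreal (L ?f) + ennreal d"
      using below_nonneg[OF cutoff(1)[OF f e(1)]] \<open>d > 0\<close> by (intro ennreal_plus) auto
    also have "\<dots> \<le> (\<Sum>m. content (U m)) + ennreal d" using 1 by (intro add_right_mono)
    finally show "ennreal (L f) \<le> (\<Sum>m. content (U m)) + ennreal d" .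
  qed
qed

text \<open>Since at most one of the functions is nonzero at each point of \<open>K\<close>, their
  sum stays at most 1 and competes for \<open>content W\<close>.\<close>

lemma content_disjoint_add:
  assumes fU: "f \<in> below U" and gV: "g \<in> below V" and W: "K \<inter> (U \<union> V) \<subseteq> W"
    and disj: "\<And>x. x \<in> K \<Longrightarrow> f x = 0 \<or> g x = 0"
  shows "ennreal (L f) + ennreal (L g) \<le> content W"
proof -
  have "(\<lambda>x. f x + g x) \<in> below W"
    unfolding below_def
  proof (intro CollectI conjI ballI)
    show "continuous_on K (\<lambda>x. f x + g x)"
      using fU gV by (auto simp: below_def intro!: continuous_intros)
    show "0 \<le> f x + g x" "f x + g x \<le> 1" if "x \<in> K" for x
      using disj[OF that] fU gV that by (auto simp: below_def)
    show "f x + g x = 0" if "x \<in> K - W" for x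
    proof -
      have "f x = 0" "g x = 0" using fU gV that W by (auto simp: below_def)
      then show ?thesis by simp
    qed
  qed
  moreover have "L (\<lambda>x. f x + g x) = L f + L g"
    using fU gV by (intro add) (auto simp: below_def)
  ultimately show ?thesis
    using content_upper[of "\<lambda>x. f x + g x" W] below_nonneg[OF fU] below_nonneg[OF gV] by simp
qed

text \<open>A competitor for \<open>W \<inter> U\<close> is truncated so that it lives on a closed
  level set. Removing that set from \<open>W\<close> leaves an open set containing
  \<open>W - U\<close>, whose competitors vanish wherever the truncated function does not.\<close>

lemma outer_split_open:
  assumes U: "open U" and W: "open W"
  shows "outer (W \<inter> U) + outer (W - U) \<le> content W"
proof -
  have "content (W \<inter> U) + outer (W - U) \<le> content W"
    unfolding content_def[of "W \<inter> U"]
  proof (subst ennreal_SUP_add_left[symmetric])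
    show "below (W \<inter> U) \<noteq> {}" using zero_below by blast
    show "(SUP f\<in>below (W \<inter> U). ennreal (L f) + outer (W - U)) \<le> content W"
    proof (rule SUP_least)
      fix f assume f: "f \<in> below (W \<inter> U)"
      show "ennreal (L f) + outer (W - U) \<le> content W"
      proof (rule ennreal_le_epsilon)
        fix d :: real assume "d > 0"
        define e where "e = d / (L (\<lambda>x. 1) + 1)"
        have L1: "L (\<lambda>x. 1) \<ge> 0" by (rule nonneg) auto
        have e: "e > 0" "e * L (\<lambda>x. 1) \<le> d" using \<open>d > 0\<close> L1 by (auto simp: e_def field_simps)
        let ?f = "\<lambda>x. max 0 (f x - e)" and ?V = "W - {x\<in>K. e \<le> f x}"
        have V: "open ?V" using W closed_level[OF f] by (rule open_Diff)
        have "outer (W - U) \<le> content ?V"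
          unfolding outer_open[OF V, symmetric]
          by (rule outer_mono) (use f e(1) in \<open>force simp: below_def\<close>)
        then have "ennreal (L ?f) + outer (W - U) \<le> ennreal (L ?f) + content ?V"
          by (rule add_left_mono)
        also have "\<dots> = (SUP g\<in>below ?V. ennreal (L ?f) + ennreal (L g))"
          unfolding content_def using zero_below by (subst ennreal_SUP_add_right) auto
        also have "\<dots> \<le> content W"
        proof (rule SUP_least)
          fix g assume g: "g \<in> below ?V"
          show "ennreal (L ?f) + ennreal (L g) \<le> content W"
          proof (rule content_disjoint_add[OF cutoff(1)[OF f e(1)] g])
            show "?f x = 0 \<or> g x = 0" if "x \<in> K" for x
              using that g by (cases "e \<le> f x") (auto simp: below_def)
          qed auto
        qed
        finally have 1: "ennreal (L ?f) + outer (W - U) \<le> content W" .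
        have "ennreal (L f) \<le> ennreal (L ?f + d)"
          using cutoff(2)[OF f e(1)] e(2) by (intro ennreal_leI) linarith
        also have "\<dots> = ennreal (L ?f) + ennreal d"
          using below_nonneg[OF cutoff(1)[OF f e(1)]] \<open>d > 0\<close> by (intro ennreal_plus) auto
        finally have "ennreal (L f) + outer (W - U) \<le> (ennreal (L ?f) + outer (W - U)) + ennreal d"
          by (simp add: add_right_mono ac_simps)
        also have "\<dots> \<le> content W + ennreal d" using 1 by (intro add_right_mono)
        finally show "ennreal (L f) + outer (W - U) \<le> content W + ennreal d" .
      qed
    qed
  qed
  then show ?thesis using outer_open[OF open_Int[OF W U]] by simp
qed

lemma outer_split:
  assumes U: "open U"
  shows "outer (E \<inter> U) + outer (E - U) \<le> outer E"
  unfolding outer_def[of E]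
proof (rule INF_greatest, clarify)
  fix W assume W: "open W" "E \<subseteq> W"
  have "outer (E \<inter> U) + outer (E - U) \<le> outer (W \<inter> U) + outer (W - U)"
    using W by (intro add_mono outer_mono) auto
  then show "outer (E \<inter> U) + outer (E - U) \<le> content W"
    using outer_split_open[OF U W(1)] by (rule order_trans)
qed

lemma outer_subadditive:
  fixes A :: "nat \<Rightarrow> 'b set"
  shows "outer (\<Union>n. A n) \<le> (\<Sum>n. outer (A n))"
proof (rule ennreal_le_epsilon)
  fix e :: real assume e: "e > 0"
  have "\<exists>U. open U \<and> A n \<subseteq> U \<and> content U \<le> outer (A n) + ennreal (e * (1/2) ^ Suc n)" for n
    by (rule outer_approx[of "e * (1/2) ^ Suc n" "A n"]) (use e in \<open>auto intro: less_imp_le\<close>)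
  then obtain U where U: "\<And>n. open (U n)" "\<And>n. A n \<subseteq> U n"
    "\<And>n. content (U n) \<le> outer (A n) + ennreal (e * (1/2) ^ Suc n)"
    using choice[of "\<lambda>n U. open U \<and> A n \<subseteq> U \<and> content U \<le> outer (A n) + ennreal (e * (1/2) ^ Suc n)"]
    by blast
  have "outer (\<Union>n. A n) \<le> outer (\<Union>n. U n)" using U(2) by (intro outer_mono) blast
  also have "\<dots> = content (\<Union>n. U n)" using U(1) by (intro outer_open) blast
  also have "\<dots> \<le> (\<Sum>n. content (U n))" by (rule content_le_sum[OF U(1)])
  also have "\<dots> \<le> (\<Sum>n. outer (A n) + ennreal (e * (1/2) ^ Suc n))"
    by (rule suminf_le) (use U(3) in auto)
  also have "\<dots> = (\<Sum>n. outer (A n)) + (\<Sum>n. ennreal (e * (1/2) ^ Suc n))"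
    by (rule suminf_add[symmetric]) auto
  also have "(\<Sum>n. ennreal (e * (1/2) ^ Suc n)) = ennreal e"
    using sums_mult[OF power_half_series, of e] e by (intro suminf_ennreal_eq) auto
  finally show "outer (\<Union>n. A n) \<le> (\<Sum>n. outer (A n)) + ennreal e" .
qed

section \<open>The representing measure and its regularity\<close>

definition riesz_measure :: "'b measure" where
  "riesz_measure = measure_of K (sets (restrict_space borel K)) outer"

lemma restrict_subset_Pow: "sets (restrict_space borel K) \<subseteq> Pow K"
  by (auto simp: sets_restrict_space)

lemma space_riesz: "space riesz_measure = K"
  by (simp add: riesz_measure_def space_measure_of[OF restrict_subset_Pow])

lemma sets_riesz: "sets riesz_measure = sets (restrict_space borel K)"
  using sets.sigma_sets_eq[of "restrict_space borel K"]
  by (simp add: riesz_measure_def sets_measure_of[OF restrict_subset_Pow] space_restrict_space)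

lemma open_riesz: "open U \<Longrightarrow> U \<inter> K \<in> sets riesz_measure"
  by (auto simp: sets_riesz sets_restrict_space)

text \<open>By \<open>outer_split\<close>, traces of open sets satisfy the Caratheodory condition;
  the sets satisfying it form a sigma-algebra, which therefore contains all Borel sets of
  \<open>K\<close>.\<close>

lemma measure_space_outer: "measure_space K (sets (restrict_space borel K)) outer"
proof -
  interpret P: sigma_algebra K "Pow K" by (rule sigma_algebra_Pow)
  have os: "outer_measure_space (Pow K) outer"
    unfolding outer_measure_space_def positive_def increasing_def countably_subadditive_def
    using outer_empty outer_mono outer_subadditive by auto
  have ms: "measure_space K (lambda_system K (Pow K) outer) outer"
    by (rule P.caratheodory_lemma[OF os])
  have sa: "sigma_algebra K (lambda_system K (Pow K) outer)"
    using ms by (simp add: measure_space_def)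
  have op: "U \<inter> K \<in> lambda_system K (Pow K) outer" if U: "open U" for U
    unfolding lambda_system_def
  proof (intro CollectI conjI ballI)
    fix E assume E: "E \<in> Pow K"
    have eq: "U \<inter> K \<inter> E = E \<inter> U" "(K - U \<inter> K) \<inter> E = E - U" using E by auto
    have "outer E \<le> outer (E \<inter> U) + outer (E - U)"
    proof -
      \<comment> \<open>Padding with empty sets derives the two-set inequality from countable
        subadditivity.\<close>
      define B :: "nat \<Rightarrow> 'b set" where "B n = (if n = 0 then E \<inter> U else if n = 1 then E - U else {})" for n
      have "(\<Union>n. B n) = E" by (auto simp: B_def split: if_splits)
      then have "outer E \<le> (\<Sum>n. outer (B n))" using outer_subadditive[of B] by simp
      also have "\<dots> = (\<Sum>n\<in>{0,1}. outer (B n))"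
        by (rule suminf_finite) (auto simp: outer_empty B_def)
      also have "\<dots> = outer (E \<inter> U) + outer (E - U)" by (simp add: B_def)
      finally show ?thesis .
    qed
    then show "outer (U \<inter> K \<inter> E) + outer ((K - U \<inter> K) \<inter> E) = outer E"
      unfolding eq using outer_split[OF U, of E] by (rule antisym[rotated])
  qed auto
  \<comment> \<open>Closedness makes \<open>K\<close> a Borel set of the ambient space, so its trace
    sigma-algebra is generated by the traces of open sets.\<close>
  have "sets (restrict_space borel K) = sigma_sets K ((\<lambda>U. U \<inter> K) ` {U. open U})"
    using sigma_sets_Int[of K UNIV "{U. open U}"] borel_closed[OF closed]
    by (simp add: sets_restrict_space borel_def Int_commute[of K] image_def)
  also have "\<dots> \<subseteq> lambda_system K (Pow K) outer"
    by (rule sigma_algebra.sigma_sets_subset[OF sa]) (use op in auto)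
  finally have sub: "sets (restrict_space borel K) \<subseteq> lambda_system K (Pow K) outer" .
  show ?thesis
    using measure_down[OF ms _ sub] sets.sigma_algebra_axioms[of "restrict_space borel K"]
    by (simp add: space_restrict_space)
qed

lemma emeasure_riesz:
  assumes "A \<in> sets riesz_measure"
  shows "emeasure riesz_measure A = outer A"
proof (rule emeasure_measure_of[OF riesz_measure_def restrict_subset_Pow _ _ assms])
  have sets_eq: "sets riesz_measure = sets (restrict_space borel K)" by (rule sets_riesz)
  show "positive (sets riesz_measure) outer" "countably_additive (sets riesz_measure) outer"
    using measure_space_outer unfolding sets_eq measure_space_def by auto
qed

lemma emeasure_riesz_total: "emeasure riesz_measure K \<le> ennreal (L (\<lambda>x. 1))"
  using emeasure_riesz[of K] outer_le_total[of K] open_riesz[of UNIV] by simp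

lemma finite_riesz: "finite_measure riesz_measure"
proof
  have "emeasure riesz_measure K < top"
    using emeasure_riesz_total by (rule le_less_trans) simp
  then show "emeasure riesz_measure (space riesz_measure) \<noteq> \<infinity>" by (simp add: space_riesz)
qed

text \<open>Approximating the complement \<open>K - B\<close> from outside by an open
  \<open>U\<close> leaves the compact set \<open>K - U\<close> inside \<open>B\<close>; the part of
  \<open>B\<close> that is lost lies in the excess of \<open>U\<close> over
  \<open>K - B\<close>.\<close>

lemma inner_regular_riesz:
  assumes B: "B \<in> sets riesz_measure"
  shows "emeasure riesz_measure B = (SUP C \<in> {C. compact C \<and> C \<subseteq> B}. emeasure riesz_measure C)"
proof (rule antisym)
  interpret finite_measure riesz_measure by (rule finite_riesz)
  have BK: "B \<subseteq> K" using sets.sets_into_space[OF B] by (simp add: space_riesz)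
  have K: "K \<in> sets riesz_measure" using sets.top[of riesz_measure] by (simp add: space_riesz)
  show "emeasure riesz_measure B \<le> (SUP C \<in> {C. compact C \<and> C \<subseteq> B}. emeasure riesz_measure C)"
  proof (rule ennreal_le_epsilon)
    fix e :: real assume "e > 0"
    then obtain U where U: "open U" "K - B \<subseteq> U" "content U < outer (K - B) + ennreal e"
      by (rule outer_approx)
    have UK: "U \<inter> K \<in> sets riesz_measure" using open_riesz[OF U(1)] .
    have C: "K - U \<in> sets riesz_measure" "compact (K - U)" "K - U \<subseteq> B"
      using sets.Diff[OF K UK] compact_diff[OF compact U(1)] U(2) by (auto simp: Diff_Int)
    have "emeasure riesz_measure (K - B) + emeasure riesz_measure (B - (K - U))
        = emeasure riesz_measure ((K - B) \<union> (B - (K - U)))"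
      by (rule plus_emeasure) (use B K C in auto)
    also have "\<dots> \<le> emeasure riesz_measure (U \<inter> K)"
      by (rule emeasure_mono) (use U(2) BK UK in auto)
    also have "\<dots> \<le> content U"
      using emeasure_riesz[OF UK] outer_mono[of "U \<inter> K" U] outer_open[OF U(1)] by simp
    also have "\<dots> \<le> emeasure riesz_measure (K - B) + ennreal e"
      using U(3) emeasure_riesz[of "K - B"] B K by simp
    finally have "emeasure riesz_measure (B - (K - U)) \<le> ennreal e"
      using emeasure_finite[of "K - B"] by (simp add: ennreal_add_left_cancel_le)
    moreover have "emeasure riesz_measure B = emeasure riesz_measure (K - U) + emeasure riesz_measure (B - (K - U))"
      using C B by (subst plus_emeasure) (auto simp: Un_absorb1)
    moreover have "emeasure riesz_measure (K - U) \<le> (SUP C \<in> {C. compact C \<and> C \<subseteq> B}. emeasure riesz_measure C)"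
      by (rule SUP_upper) (use C in auto)
    ultimately show "emeasure riesz_measure B
        \<le> (SUP C \<in> {C. compact C \<and> C \<subseteq> B}. emeasure riesz_measure C) + ennreal e"
      by (simp add: add_mono)
  qed
qed (auto intro!: SUP_least emeasure_mono B)

lemma radon_riesz: "radon_on K riesz_measure"
  unfolding radon_on_def using space_riesz sets_riesz finite_riesz inner_regular_riesz by blast

lemma integrable_riesz:
  fixes f :: "'b \<Rightarrow> real"
  assumes "continuous_on K f"
  shows "integrable riesz_measure f"
  by (rule radon_integrable[OF compact radon_riesz assms])

section \<open>Integration against the representing measure\<close>

lemma below_le_emeasure:
  assumes f: "f \<in> below V" and V: "open V"
  shows "L f \<le> measure riesz_measure (V \<inter> K)"
proof -
  interpret finite_measure riesz_measure by (rule finite_riesz)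
  have "ennreal (L f) \<le> content V" by (rule content_upper[OF f])
  also have "\<dots> \<le> outer (V \<inter> K)"
    unfolding outer_def by (rule INF_greatest) (auto intro: content_mono)
  also have "\<dots> = ennreal (measure riesz_measure (V \<inter> K))"
    using emeasure_riesz[OF open_riesz[OF V]] emeasure_eq_measure by simp
  finally show ?thesis by (simp add: ennreal_le_iff)
qed

text \<open>Layer cake: \<open>f\<close> is the average of its \<open>n\<close> slices, each of which is squeezed between
  the indicators of consecutive superlevel sets.\<close>

lemma le_integral_unit:
  assumes f: "continuous_on K f" and f01: "\<And>x. x \<in> K \<Longrightarrow> 0 \<le> f x \<and> f x \<le> 1"
  shows "L f \<le> integral\<^sup>L riesz_measure f"
proof -
  interpret finite_measure riesz_measure by (rule finite_riesz)
  let ?M = "measure riesz_measure K" and ?I = "integral\<^sup>L riesz_measure"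
  have bound: "real (Suc m) * L f \<le> ?M + real (Suc m) * ?I f" for m
  proof -
    \<comment> \<open>The slice of \<open>(Suc m) f\<close> between the heights \<open>i\<close> and
      \<open>i + 1\<close>.\<close>
    define s where "s i x = max 0 (min 1 (real (Suc m) * f x - real i))" for i x
    have cs: "continuous_on K (s i)" for i
      unfolding s_def by (intro continuous_intros f)
    have sum_s: "(\<Sum>i<n. max 0 (min 1 (t - real i))) = t" if "0 \<le> t" "t \<le> real n" for t and n :: nat
      using that
    proof (induction n)
      case (Suc n)
      show ?case
      proof (cases "t \<le> real n")
        case False
        have "(\<Sum>i<n. max 0 (min 1 (t - real i))) = (\<Sum>i<n. 1)"
          by (rule sum.cong) (use False in \<open>auto simp: min_def max_def\<close>)
        then show ?thesis using False Suc.prems by (simp add: min_def max_def)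
      qed (use Suc in \<open>simp add: max_def min_def\<close>)
    qed simp
    have avg: "(\<Sum>i<Suc m. s i x) = real (Suc m) * f x" if "x \<in> K" for x
      unfolding s_def using f01[OF that] by (intro sum_s) (auto intro: mult_left_le)
    have "\<exists>V. open V \<and> V \<inter> K = {x\<in>K. real i < real (Suc m) * f x}" for i
    proof -
      have "openin (top_of_set K) (K \<inter> (\<lambda>x. real (Suc m) * f x) -` {real i<..})"
        by (intro continuous_openin_preimage_gen continuous_intros f)
      moreover have "K \<inter> (\<lambda>x. real (Suc m) * f x) -` {real i<..} = {x\<in>K. real i < real (Suc m) * f x}"
        by auto
      ultimately show ?thesis by (auto simp: openin_open inf_commute)
    qed
    then obtain V where V: "\<And>i. open (V i)" "\<And>i. V i \<inter> K = {x\<in>K. real i < real (Suc m) * f x}"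
      by metis
    have upper: "L (s i) \<le> measure riesz_measure (V i \<inter> K)" for i
    proof (rule below_le_emeasure[OF _ V(1)])
      show "s i \<in> below (V i)"
        unfolding below_def using cs V(2)[of i] by (auto simp: s_def)
    qed
    have lower: "measure riesz_measure (V (Suc i) \<inter> K) \<le> ?I (s i)" for i
    proof -
      have "measure riesz_measure (V (Suc i) \<inter> K) = ?I (indicator (V (Suc i) \<inter> K))"
        using sets.sets_into_space[OF open_riesz[OF V(1)[of "Suc i"]]] by (simp add: Int_absorb2)
      also have "\<dots> \<le> ?I (s i)"
      proof (rule integral_mono)
        show "integrable riesz_measure (indicator (V (Suc i) \<inter> K) :: _ \<Rightarrow> real)"
          using open_riesz[OF V(1)] by (simp add: integrable_real_indicator emeasure_finite less_top[symmetric])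
        show "integrable riesz_measure (s i)" by (rule integrable_riesz[OF cs])
        show "indicator (V (Suc i) \<inter> K) x \<le> s i x" for x
          unfolding V(2) by (auto simp: s_def indicator_def)
      qed
      finally show ?thesis .
    qed
    have "real (Suc m) * L f = L (\<lambda>x. real (Suc m) * f x)" using scale[OF f] by simp
    also have "\<dots> \<le> L (\<lambda>x. \<Sum>i<Suc m. s i x)"
      by (rule mono) (use avg in \<open>auto intro!: continuous_intros f cs simp del: sum.lessThan_Suc\<close>)
    also have "\<dots> = (\<Sum>i<Suc m. L (s i))" by (rule sum) (auto intro: cs)
    also have "\<dots> \<le> (\<Sum>i<Suc m. measure riesz_measure (V i \<inter> K))" by (intro sum_mono upper)
    \<comment> \<open>The upper estimate uses \<open>V i\<close>, the lower one
      \<open>V (Suc i)\<close>. Shifting the index leaves only the term of \<open>V 0\<close>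
      unmatched, and it is at most the total mass.\<close>
    also have "\<dots> = measure riesz_measure (V 0 \<inter> K) + (\<Sum>i<m. measure riesz_measure (V (Suc i) \<inter> K))"
      by (rule sum.lessThan_Suc_shift)
    also have "\<dots> \<le> ?M + (\<Sum>i<m. ?I (s i))"
    proof (intro add_mono sum_mono lower)
      show "measure riesz_measure (V 0 \<inter> K) \<le> ?M"
        using sets.top[of riesz_measure] by (intro finite_measure_mono) (auto simp: space_riesz)
    qed
    also have "\<dots> \<le> ?M + (\<Sum>i<Suc m. ?I (s i))"
      by (simp add: integral_nonneg_AE s_def)
    also have "(\<Sum>i<Suc m. ?I (s i)) = ?I (\<lambda>x. \<Sum>i<Suc m. s i x)"
      by (rule Bochner_Integration.integral_sum[symmetric]) (rule integrable_riesz[OF cs])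
    also have "\<dots> = ?I (\<lambda>x. real (Suc m) * f x)"
      by (rule Bochner_Integration.integral_cong[OF refl]) (use avg in \<open>simp add: space_riesz del: sum.lessThan_Suc\<close>)
    also have "\<dots> = real (Suc m) * ?I f" by simp
    finally show ?thesis .
  qed
  \<comment> \<open>The error \<open>?M\<close> in \<open>bound\<close> does not grow with
    \<open>m\<close>, so a positive gap is refuted by a large \<open>m\<close>.\<close>
  have "L f - ?I f \<le> 0"
  proof (rule ccontr)
    assume "\<not> L f - ?I f \<le> 0"
    then obtain m where "?M < real (Suc m) * (L f - ?I f)"
      using ex_less_of_nat_mult[of "L f - ?I f" ?M]
      by (metis not_le Suc_n_not_le_n less_le_trans linear mult_right_mono of_nat_mono order_less_imp_le le_SucI)
    then show False using bound[of m] by (simp add: algebra_simps)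
  qed
  then show ?thesis by simp
qed

lemma total_riesz: "measure riesz_measure K = L (\<lambda>x. 1)"
proof (rule antisym)
  interpret finite_measure riesz_measure by (rule finite_riesz)
  show "measure riesz_measure K \<le> L (\<lambda>x. 1)"
    using emeasure_riesz_total by (simp add: emeasure_eq_measure nonneg ennreal_le_iff)
  show "L (\<lambda>x. 1) \<le> measure riesz_measure K"
    using le_integral_unit[of "\<lambda>x. 1"] by (simp add: space_riesz)
qed

lemma le_integral:
  assumes f: "continuous_on K f"
  shows "L f \<le> integral\<^sup>L riesz_measure f"
proof -
  interpret finite_measure riesz_measure by (rule finite_riesz)
  obtain B where B: "B > 0" "\<And>x. x \<in> K \<Longrightarrow> \<bar>f x\<bar> \<le> B"
    using compact_imp_bounded[OF compact_continuous_image[OF f compact]]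
    unfolding bounded_pos by auto
  \<comment> \<open>An affine change brings the values into \<open>[0, 1]\<close>; the constant
    causes no loss because \<open>total_riesz\<close> is an equality.\<close>
  let ?g = "\<lambda>x. 1 / (2 * B) * (f x + B * 1)"
  have "L ?g \<le> integral\<^sup>L riesz_measure ?g"
  proof (rule le_integral_unit)
    show "0 \<le> ?g x \<and> ?g x \<le> 1" if "x \<in> K" for x
      using B(1) B(2)[OF that] by (auto simp: field_simps abs_le_iff)
  qed (intro continuous_intros f)
  moreover have "L ?g = 1 / (2 * B) * (L f + B * L (\<lambda>x. 1))"
    by (subst scale, intro continuous_intros f, subst add, intro f, intro continuous_intros, subst scale) auto
  moreover have "integral\<^sup>L riesz_measure ?g = 1 / (2 * B) * (integral\<^sup>L riesz_measure f + B * L (\<lambda>x. 1))"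
    using integrable_riesz[OF f] by (simp add: space_riesz total_riesz)
  ultimately show ?thesis using B(1) by (simp add: divide_le_cancel)
qed

theorem integral_riesz:
  assumes f: "continuous_on K f"
  shows "integral\<^sup>L riesz_measure f = L f"
  using le_integral[OF f] le_integral[of "\<lambda>x. - f x"] scale[OF f, of "-1"] f
  by (simp add: continuous_on_minus)

end

section \<open>The compactification and minimal measures\<close>

lemma restrict_Mtilde_in_Cb_tilde:
  assumes "continuous_on Mtilde g" and "\<And>p. p \<in> Mtilde \<Longrightarrow> \<bar>g p\<bar> \<le> B"
  shows "(\<lambda>p. if p \<in> Mtilde then g p else 0) \<in> Cb_tilde"
proof -
  have "continuous_on Mtilde (\<lambda>p. if p \<in> Mtilde then g p else 0)"
    using assms(1) by (rule continuous_on_eq) simp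
  moreover have "bounded ((\<lambda>p. if p \<in> Mtilde then g p else 0) ` Mtilde)"
    unfolding bounded_iff using assms(2) by (intro exI[of _ B]) auto
  ultimately show ?thesis by (simp add: Cb_tilde_def)
qed

lemma Hausdorff_space_fun: "Hausdorff_space (euclidean :: ('i \<Rightarrow> real) topology)"
  unfolding euclidean_product_topology[symmetric] Hausdorff_space_product_topology by simp

lemma evb_in_betaM: "p \<in> Mtilde \<Longrightarrow> evb p \<in> betaM"
  unfolding betaM_def by (intro subsetD[OF closure_subset] imageI)

text \<open>Tychonoff's theorem: each coordinate of \<open>evb p\<close> is bounded independently of
  \<open>p\<close>.\<close>

lemma compact_betaM: "compact (betaM :: (('a::metric_space \<times> 'a \<Rightarrow> real) \<Rightarrow> real) set)"
proof -
  have "\<exists>B. \<forall>p\<in>Mtilde. \<bar>g p\<bar> \<le> B" if "g \<in> Cb_tilde" for g :: "'a \<times> 'a \<Rightarrow> real"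
    using that unfolding Cb_tilde_def bounded_iff by auto
  then obtain B where B: "\<And>(g :: 'a \<times> 'a \<Rightarrow> real) p. g \<in> Cb_tilde \<Longrightarrow> p \<in> Mtilde \<Longrightarrow> \<bar>g p\<bar> \<le> B g"
    by metis
  \<comment> \<open>The absolute value keeps 0, the default of \<open>evb\<close> outside
    \<open>Cb_tilde\<close>, in every interval.\<close>
  define Q where "Q = PiE UNIV (\<lambda>g :: 'a \<times> 'a \<Rightarrow> real. {- \<bar>B g\<bar>..\<bar>B g\<bar>})"
  have "compactin (product_topology (\<lambda>i. euclidean) UNIV) Q"
    unfolding Q_def by (simp add: compactin_PiE)
  then have Q: "compact Q" by (simp add: euclidean_product_topology)
  have "evb ` Mtilde \<subseteq> Q"
  proof clarify
    fix x y :: 'a assume p: "(x, y) \<in> Mtilde"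
    have "evb (x, y) g \<in> {- \<bar>B g\<bar>..\<bar>B g\<bar>}" for g
      using B[of g "(x, y)"] p by (auto simp: evb_def abs_le_iff)
    then show "evb (x, y) \<in> Q" by (simp add: Q_def PiE_UNIV_domain)
  qed
  then have "betaM \<subseteq> Q"
    unfolding betaM_def using compactin_imp_closedin[OF Hausdorff_space_fun, of Q] Q by (intro closure_minimal) auto
  then show ?thesis
    using Q closed_closure[of "evb ` (Mtilde :: ('a \<times> 'a) set)"] unfolding betaM_def
    by (metis compact_Int_closed Int_absorb1)
qed

lemma continuous_on_eval: "continuous_on S (\<lambda>\<xi> :: 'i \<Rightarrow> real. \<xi> g)"
  by (rule continuous_on_subset[OF continuous_on_product_coordinates]) simp

lemma betaM_dense:
  assumes "open W" "\<xi> \<in> W" "\<xi> \<in> betaM"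
  obtains p where "p \<in> Mtilde" "evb p \<in> W"
proof -
  have "evb ` Mtilde \<inter> W \<noteq> {}"
    using assms unfolding betaM_def closure_iff_nhds_not_empty by blast
  then show ?thesis using that by blast
qed

text \<open>Density transfers inequalities from genuine pairs to the compactification; the open set
  \<open>W\<close> permits this for inequalities known only locally.\<close>

lemma betaM_nonneg:
  fixes F :: "_ \<Rightarrow> real"
  assumes F: "continuous_on betaM F" and W: "open W" "\<xi> \<in> W" "\<xi> \<in> betaM"
    and nonneg: "\<And>p. p \<in> Mtilde \<Longrightarrow> evb p \<in> W \<Longrightarrow> 0 \<le> F (evb p)"
  shows "0 \<le> F \<xi>"
proof (rule ccontr)
  assume neg: "\<not> 0 \<le> F \<xi>"
  have "openin (top_of_set betaM) (betaM \<inter> F -` {..<0})"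
    by (intro continuous_openin_preimage_gen F) simp
  then obtain V where V: "open V" "betaM \<inter> F -` {..<0} = betaM \<inter> V"
    by (auto simp: openin_open)
  then have "\<xi> \<in> V \<inter> W" using neg W by auto
  then obtain p where "p \<in> Mtilde" "evb p \<in> V \<inter> W"
    using betaM_dense[of "V \<inter> W" \<xi>] V(1) W by blast
  moreover from this have "evb p \<in> betaM \<inter> F -` {..<0}"
    unfolding V(2) using evb_in_betaM[of p] by blast
  ultimately show False using nonneg[of p] by auto
qed

section \<open>The cone of test functions and minimality\<close>

lemma GsetD:
  assumes "g \<in> Gset"
  shows "continuous_on betaM g"
    and "x \<noteq> u \<Longrightarrow> u \<noteq> y \<Longrightarrow> x \<noteq> y \<Longrightarrow>
      dist x y * g (evb (x, y)) \<le> dist x u * g (evb (x, u)) + dist u y * g (evb (u, y))"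
  using assms by (auto simp: Gset_def)

lemma Gset_add: "f \<in> Gset \<Longrightarrow> g \<in> Gset \<Longrightarrow> (\<lambda>\<xi>. f \<xi> + g \<xi>) \<in> Gset"
  unfolding Gset_def by (auto intro!: continuous_intros simp: distrib_left) (smt (verit))

lemma Gset_scale:
  assumes "g \<in> Gset" "0 \<le> c"
  shows "(\<lambda>\<xi>. c * g \<xi>) \<in> Gset"
  unfolding Gset_def
proof (intro CollectI conjI allI impI)
  show "continuous_on betaM (\<lambda>\<xi>. c * g \<xi>)" using assms by (auto simp: Gset_def intro!: continuous_intros)
  fix x u y :: 'a assume "x \<noteq> u \<and> u \<noteq> y \<and> x \<noteq> y"
  then have "c * (dist x y * g (evb (x, y))) \<le> c * (dist x u * g (evb (x, u)) + dist u y * g (evb (u, y)))"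
    using assms GsetD(2) by (intro mult_left_mono) auto
  then show "dist x y * (c * g (evb (x, y))) \<le> dist x u * (c * g (evb (x, u))) + dist u y * (c * g (evb (u, y)))"
    by (simp add: algebra_simps)
qed

text \<open>For constants the defining inequality is the triangle inequality of \<open>dist\<close>.
  They supply majorants of bounded functions in the duality argument.\<close>

lemma Gset_const: "0 \<le> c \<Longrightarrow> (\<lambda>\<xi>. c) \<in> Gset"
  unfolding Gset_def
  by (auto simp: distrib_right[symmetric] intro!: mult_right_mono dist_triangle)

text \<open>The linear functionals below \<open>P f = inf {\<integral>g d\<mu> | g \<in> G, g \<ge> f}\<close> are the positive measures
  preceding \<open>\<mu>\<close>; one that touches \<open>P\<close> at \<open>- g0\<close> must, by minimality, give \<open>g0\<close> the same integral
  as \<open>\<mu>\<close>.\<close>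

lemma preceq_minimal_dual:
  fixes \<mu> :: "(('a::metric_space \<times> 'a \<Rightarrow> real) \<Rightarrow> real) measure"
  assumes radon: "radon_on betaM \<mu>" and minimal: "preceq_minimal \<mu>"
    and g0: "g0 \<in> Gset" and e: "0 < e"
  obtains h where "h \<in> Gset" "\<And>\<xi>. \<xi> \<in> betaM \<Longrightarrow> - g0 \<xi> \<le> h \<xi>"
    "integral\<^sup>L \<mu> h < - integral\<^sup>L \<mu> g0 + e"
proof -
  let ?K = "betaM :: (('a \<times> 'a \<Rightarrow> real) \<Rightarrow> real) set"
  define V where "V = {f :: (('a \<times> 'a \<Rightarrow> real) \<Rightarrow> real) \<Rightarrow> real. continuous_on ?K f}"
  define J where "J f = integral\<^sup>L \<mu> ` {g \<in> Gset. \<forall>\<xi>\<in>?K. f \<xi> \<le> g \<xi>}" for f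
  define P where "P f = Inf (J f)" for f
  interpret V: function_subspace V
    by standard (auto simp: V_def intro!: continuous_intros)
  have int: "integrable \<mu> f" if "f \<in> V" for f
    using that radon_integrable[OF compact_betaM radon] by (simp add: V_def)
  have GV: "g \<in> V" if "g \<in> Gset" for g using that GsetD(1) by (simp add: V_def)
  have space: "space \<mu> = ?K" using radon by (simp add: radon_on_def)
  have ne: "J f \<noteq> {}" if "f \<in> V" for f
  proof -
    have "bounded (f ` ?K)"
      using that compact_betaM by (intro compact_imp_bounded compact_continuous_image) (auto simp: V_def)
    then obtain B where B: "0 < B" "\<And>\<xi>. \<xi> \<in> ?K \<Longrightarrow> \<bar>f \<xi>\<bar> \<le> B"
      unfolding bounded_pos by auto
    have "(\<lambda>\<xi>. B) \<in> {g \<in> Gset. \<forall>\<xi>\<in>?K. f \<xi> \<le> g \<xi>}"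
      using B Gset_const[of B] by (auto simp: abs_le_iff)
    then show ?thesis unfolding J_def by blast
  qed
  have bdd: "bdd_below (J f)" if f: "f \<in> V" for f
    unfolding J_def
    by (rule bdd_belowI2[of _ "integral\<^sup>L \<mu> f"]) (auto intro!: integral_mono int f GV simp: space)
  have le: "P f \<le> integral\<^sup>L \<mu> g" if "f \<in> V" "g \<in> Gset" "\<forall>\<xi>\<in>?K. f \<xi> \<le> g \<xi>" for f g
    unfolding P_def by (rule cInf_lower[OF _ bdd[OF that(1)]]) (use that in \<open>auto simp: J_def\<close>)
  have approx: "\<exists>g\<in>Gset. (\<forall>\<xi>\<in>?K. f \<xi> \<le> g \<xi>) \<and> integral\<^sup>L \<mu> g < P f + d" if "f \<in> V" "d > 0" for f d
    using cInf_lessD[OF ne, of f "P f + d"] that by (auto simp: J_def P_def)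
  have sub: "sublinear_on V P"
    unfolding sublinear_on_def
  proof (intro conjI ballI allI impI)
    fix f g assume f: "f \<in> V" and g: "g \<in> V"
    show "P (\<lambda>x. f x + g x) \<le> P f + P g"
    proof (rule field_le_epsilon)
      fix d :: real assume "d > 0"
      obtain f' where f': "f' \<in> Gset" "\<forall>\<xi>\<in>?K. f \<xi> \<le> f' \<xi>" "integral\<^sup>L \<mu> f' < P f + d/2"
        using approx[OF f, of "d/2"] \<open>d > 0\<close> by auto
      obtain g' where g': "g' \<in> Gset" "\<forall>\<xi>\<in>?K. g \<xi> \<le> g' \<xi>" "integral\<^sup>L \<mu> g' < P g + d/2"
        using approx[OF g, of "d/2"] \<open>d > 0\<close> by auto
      have "P (\<lambda>x. f x + g x) \<le> integral\<^sup>L \<mu> (\<lambda>\<xi>. f' \<xi> + g' \<xi>)"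
        using f' g' by (intro le V.add_mem f g Gset_add) (auto intro: add_mono)
      also have "\<dots> = integral\<^sup>L \<mu> f' + integral\<^sup>L \<mu> g'"
        using f'(1) g'(1) by (intro Bochner_Integration.integral_add int GV)
      finally show "P (\<lambda>x. f x + g x) \<le> P f + P g + d" using f'(3) g'(3) by simp
    qed
  next
    fix f and c :: real assume f: "f \<in> V" and c: "c > 0"
    show "P (\<lambda>x. c * f x) \<le> c * P f"
    proof (rule field_le_epsilon)
      fix d :: real assume "d > 0"
      obtain f' where f': "f' \<in> Gset" "\<forall>\<xi>\<in>?K. f \<xi> \<le> f' \<xi>" "integral\<^sup>L \<mu> f' < P f + d/c"
        using approx[OF f, of "d/c"] \<open>d > 0\<close> c by auto
      have "P (\<lambda>x. c * f x) \<le> integral\<^sup>L \<mu> (\<lambda>\<xi>. c * f' \<xi>)"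
        using f' c by (intro le V.scale_mem f Gset_scale) auto
      also have "\<dots> = c * integral\<^sup>L \<mu> f'" by simp
      also have "\<dots> \<le> c * (P f + d/c)" using f'(3) c by (intro mult_left_mono) auto
      also have "\<dots> = c * P f + d" using c by (simp add: distrib_left)
      finally show "P (\<lambda>x. c * f x) \<le> c * P f + d" .
    qed
  qed
  have neg_g0: "(\<lambda>\<xi>. - g0 \<xi>) \<in> V" using V.uminus_mem[OF GV[OF g0]] .
  obtain L where L: "linear_functional_on V L" "\<forall>f\<in>V. L f \<le> P f" "L (\<lambda>\<xi>. - g0 \<xi>) = P (\<lambda>\<xi>. - g0 \<xi>)"
    by (rule V.Hahn_Banach[OF sub neg_g0], rule that)
  have scale: "L (\<lambda>x. c * f x) = c * L f" if "f \<in> V" for f c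
    using L(1) that by (simp add: linear_functional_on_def)
  have pos: "0 \<le> L f" if f: "f \<in> V" "\<And>\<xi>. \<xi> \<in> ?K \<Longrightarrow> 0 \<le> f \<xi>" for f
  proof -
    have "L (\<lambda>\<xi>. - f \<xi>) \<le> P (\<lambda>\<xi>. - f \<xi>)" using L(2) V.uminus_mem[OF f(1)] by blast
    \<comment> \<open>The zero function lies in \<open>G\<close> and majorizes \<open>- f\<close>;
      this is the source of the positivity of \<open>L\<close>.\<close>
    also have "\<dots> \<le> integral\<^sup>L \<mu> (\<lambda>\<xi>. 0)"
      using f(2) Gset_const[of 0] by (intro le V.uminus_mem f(1)) auto
    finally show ?thesis using scale[OF f(1), of "-1"] by simp
  qed
  interpret L: positive_functional ?K L
  proof
    show "compact ?K" by (rule compact_betaM)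
    show "closed ?K" by (simp add: betaM_def)
    show "Hausdorff_space (top_of_set ?K)"
      by (rule Hausdorff_space_subtopology[OF Hausdorff_space_fun])
    show "L (\<lambda>x. f x + g x) = L f + L g" if "continuous_on ?K f" "continuous_on ?K g" for f g
      using L(1) that by (simp add: linear_functional_on_def V_def)
    show "L (\<lambda>x. c * f x) = c * L f" if "continuous_on ?K f" for f c
      using scale that by (simp add: V_def)
    show "0 \<le> L f" if "continuous_on ?K f" "\<And>x. x \<in> ?K \<Longrightarrow> 0 \<le> f x" for f
      using pos that by (simp add: V_def)
  qed
  have "preceq L.riesz_measure \<mu>"
    unfolding preceq_def
  proof
    fix g :: "(('a \<times> 'a \<Rightarrow> real) \<Rightarrow> real) \<Rightarrow> real" assume g: "g \<in> Gset"
    have "L g \<le> P g" using L(2) GV[OF g] by blast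
    also have "\<dots> \<le> integral\<^sup>L \<mu> g" using g GV by (intro le) auto
    finally show "integral\<^sup>L L.riesz_measure g \<le> integral\<^sup>L \<mu> g"
      using L.integral_riesz[OF GsetD(1)[OF g]] by simp
  qed
  \<comment> \<open>Minimality reverses the relation. At \<open>g0\<close> this reads
    \<open>\<integral>g0 d\<mu> <= L g0 = - P (- g0)\<close>, so near-optimal majorants of
    \<open>- g0\<close> have the desired small integral.\<close>
  then have "preceq \<mu> L.riesz_measure"
    using minimal L.radon_riesz by (simp add: preceq_minimal_def)
  then have "integral\<^sup>L \<mu> g0 \<le> L g0"
    using g0 L.integral_riesz[OF GsetD(1)[OF g0]] by (auto simp: preceq_def)
  then have "P (\<lambda>\<xi>. - g0 \<xi>) \<le> - integral\<^sup>L \<mu> g0"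
    using L(3) scale[OF GV[OF g0], of "-1"] by simp
  then show thesis
    using approx[OF neg_g0 e] that by (metis (no_types, lifting) add_right_mono less_le_trans)
qed

section \<open>Discounted shortest paths\<close>

text \<open>Shortest-path potential: \<open>u y\<close> is the cheapest way to reach \<open>y\<close> from \<open>A\<close> when a step from \<open>x\<close>
  to \<open>y\<close> costs \<open>c x y + c0 x y\<close>, with \<open>c0\<close> discounted by the factor \<open>1 - b\<close> once the path has
  touched \<open>U\<close>. By the triangle inequalities two kinds of paths suffice.\<close>

lemma discounted_potential:
  fixes c c0 :: "'a::metric_space \<Rightarrow> 'a \<Rightarrow> real"
  assumes A: "A \<noteq> {}" and b: "0 \<le> b" "b \<le> 1"
    and c_tri: "\<And>x u y. c x y \<le> c x u + c u y" and c_refl: "\<And>x. c x x = 0"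
    and c_low: "\<And>x y. - c0 x y \<le> c x y" and c_up: "\<And>x y. c x y + c0 x y \<le> C * dist x y"
    and c0_tri: "\<And>x u y. c0 x y \<le> c0 x u + c0 u y" and c0_refl: "\<And>x. c0 x x = 0"
    and c0_nonneg: "\<And>x y. 0 \<le> c0 x y"
    and detour: "\<And>a a' x. a \<in> A \<Longrightarrow> a' \<in> A \<Longrightarrow> x \<in> U \<Longrightarrow> c0 a a' \<le> (1 - b) * (c0 a x + c0 x a')"
  obtains u where "\<And>x y. \<bar>u x - u y\<bar> \<le> C * dist x y" "\<And>a. a \<in> A \<Longrightarrow> u a = 0"
    "\<And>x y. u y - u x \<le> c x y + c0 x y"
    "\<And>x y. x \<in> U \<or> y \<in> U \<Longrightarrow> u y - u x \<le> c x y + (1 - b) * c0 x y"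
proof -
  \<comment> \<open>The term \<open>c a y\<close> is not broken up, since by its triangle inequality
    the direct value is the cheapest; one visited point \<open>x\<close> of \<open>U\<close> earns
    the discount on the whole of \<open>c0\<close>.\<close>
  define T where "T y = {c a y + c0 a y | a. a \<in> A} \<union>
    {c a y + (1 - b) * (c0 a x + c0 x y) | a x. a \<in> A \<and> x \<in> U}" for y
  define u where "u y = Inf (T y)" for y
  have ne: "T y \<noteq> {}" for y using A by (auto simp: T_def)
  have disc: "(1 - b) * s \<le> s" if "0 \<le> s" for s :: real
    using b that by (intro mult_left_le_one_le) auto
  have step: "\<exists>r'\<in>T y. r' \<le> r + c x y + c0 x y" if "r \<in> T x" for r x y
  proof -
    from that consider (direct) a where "a \<in> A" "r = c a x + c0 a x"
      | (via) a v where "a \<in> A" "v \<in> U" "r = c a x + (1 - b) * (c0 a v + c0 v x)"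
      unfolding T_def by blast
    then show ?thesis
    proof cases
      case (direct a)
      note a = direct
      then have "c a y + c0 a y \<le> r + c x y + c0 x y"
        using c_tri[of a y x] c0_tri[of a y x] by simp
      then show ?thesis using a(1) unfolding T_def by blast
    next
      case (via a v)
      note a = via
      have "(1 - b) * (c0 a v + c0 v y) \<le> (1 - b) * (c0 a v + c0 v x + c0 x y)"
        using c0_tri[of v y x] b by (intro mult_left_mono) auto
      also have "\<dots> \<le> (1 - b) * (c0 a v + c0 v x) + c0 x y"
        using disc[OF c0_nonneg[of x y]] by (simp add: distrib_left)
      finally have "c a y + (1 - b) * (c0 a v + c0 v y) \<le> r + c x y + c0 x y"
        using c_tri[of a y x] a(3) by simp
      then show ?thesis using a(1,2) unfolding T_def by blast
    qed
  qed
  have step_U: "\<exists>r'\<in>T y. r' \<le> r + c x y + (1 - b) * c0 x y" if r: "r \<in> T x" and xy: "x \<in> U \<or> y \<in> U" for r x y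
  proof -
    from r consider (direct) a where "a \<in> A" "r = c a x + c0 a x"
      | (via) a v where "a \<in> A" "v \<in> U" "r = c a x + (1 - b) * (c0 a v + c0 v x)"
      unfolding T_def by blast
    then show ?thesis
    proof cases
      case (direct a)
      note a = direct
      \<comment> \<open>The visit to \<open>U\<close> is \<open>x\<close> itself or the endpoint
        \<open>y\<close>, the latter with \<open>c0 y y = 0\<close>.\<close>
      obtain v where v: "v \<in> U" "c0 a v + c0 v y \<le> c0 a x + c0 x y"
        using xy c0_refl c0_tri[of a y x] by force
      have "(1 - b) * (c0 a v + c0 v y) \<le> (1 - b) * (c0 a x + c0 x y)"
        using v(2) b by (intro mult_left_mono) auto
      also have "\<dots> \<le> c0 a x + (1 - b) * c0 x y"
        using disc[OF c0_nonneg[of a x]] by (simp add: distrib_left)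
      finally have "c a y + (1 - b) * (c0 a v + c0 v y) \<le> r + c x y + (1 - b) * c0 x y"
        using c_tri[of a y x] a(2) by simp
      then show ?thesis using a(1) v(1) unfolding T_def by blast
    next
      case (via a v)
      note a = via
      have "(1 - b) * (c0 a v + c0 v y) \<le> (1 - b) * (c0 a v + c0 v x + c0 x y)"
        using c0_tri[of v y x] b by (intro mult_left_mono) auto
      then have "c a y + (1 - b) * (c0 a v + c0 v y) \<le> r + c x y + (1 - b) * c0 x y"
        using c_tri[of a y x] a(3) by (simp add: distrib_left)
      then show ?thesis using a(1,2) unfolding T_def by blast
    qed
  qed
  \<comment> \<open>No path between points of \<open>A\<close> has negative cost:
    \<open>detour\<close> ensures that \<open>c_low\<close> survives the discount.\<close>
  have T_A: "0 \<le> r" if "r \<in> T a'" "a' \<in> A" for r a'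
  proof -
    have "0 \<le> c a a' + (1 - b) * (c0 a x + c0 x a')" if "a \<in> A" "x \<in> U" for a x
      using c_low[of a a'] detour[OF that(1) \<open>a' \<in> A\<close> that(2)] by linarith
    moreover have "0 \<le> c a a' + c0 a a'" for a using c_low[of a a'] by linarith
    ultimately show ?thesis using that(1) unfolding T_def by blast
  qed
  have bdd: "bdd_below (T y)" for y
  proof -
    obtain a where a: "a \<in> A" using A by blast
    \<comment> \<open>Prolonging a path from \<open>y\<close> to a point \<open>a\<close> of
      \<open>A\<close> must give a nonnegative cost.\<close>
    have "- (c y a + c0 y a) \<le> r" if "r \<in> T y" for r
      using step[OF that, of a] T_A[OF _ a] by force
    then show ?thesis by (rule bdd_belowI)
  qed
  have u_le: "u y \<le> r" if "r \<in> T y" for r y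
    unfolding u_def using bdd that by (intro cInf_lower)
  have cost: "u y - u x \<le> c x y + c0 x y" for x y
  proof -
    have "u y - (c x y + c0 x y) \<le> u x"
      unfolding u_def[of x]
    proof (rule cInf_greatest[OF ne])
      fix r assume "r \<in> T x"
      then obtain r' where "r' \<in> T y" "r' \<le> r + c x y + c0 x y" using step by blast
      then show "u y - (c x y + c0 x y) \<le> r" using u_le[of r' y] by simp
    qed
    then show ?thesis by simp
  qed
  show thesis
  proof
    show "u y - u x \<le> c x y + c0 x y" for x y by (rule cost)
    show "\<bar>u x - u y\<bar> \<le> C * dist x y" for x y
      using cost[of x y] cost[of y x] c_up[of x y] c_up[of y x] by (simp add: abs_le_iff dist_commute)
    show "u a = 0" if "a \<in> A" for a
    proof (rule antisym)
      have "c a a + c0 a a \<in> T a" using that unfolding T_def by blast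
      then show "u a \<le> 0" using u_le[of "c a a + c0 a a" a] by (simp add: c_refl c0_refl)
      show "0 \<le> u a" unfolding u_def using T_A that by (intro cInf_greatest ne)
    qed
    fix x y assume U: "x \<in> U \<or> y \<in> U"
    have "u y - (c x y + (1 - b) * c0 x y) \<le> u x"
      unfolding u_def[of x]
    proof (rule cInf_greatest[OF ne])
      fix r assume "r \<in> T x"
      then obtain r' where "r' \<in> T y" "r' \<le> r + c x y + (1 - b) * c0 x y" using step_U U by blast
      then show "u y - (c x y + (1 - b) * c0 x y) \<le> r" using u_le[of r' y] by simp
    qed
    then show "u y - u x \<le> c x y + (1 - b) * c0 x y" by simp
  qed
qed

text \<open>This is the metric \<open>c0\<close> of the overview; \<open>dist_closeness\<close>
  relates it to \<open>g0\<close>.\<close>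

definition bounded_dist :: "'a::metric_space \<Rightarrow> 'a \<Rightarrow> real" where
  "bounded_dist x y = dist x y / (1 + dist x y)"

lemma divide_one_plus_mono:
  fixes s t :: real
  assumes "0 \<le> s" "s \<le> t"
  shows "s / (1 + s) \<le> t / (1 + t)"
  using assms by (simp add: field_simps)

lemma bounded_dist_triangle: "bounded_dist x y \<le> bounded_dist x u + bounded_dist u y"
proof -
  have "bounded_dist x y \<le> (dist x u + dist u y) / (1 + (dist x u + dist u y))"
    unfolding bounded_dist_def by (intro divide_one_plus_mono dist_triangle) auto
  also have "\<dots> = dist x u / (1 + (dist x u + dist u y)) + dist u y / (1 + (dist x u + dist u y))"
    by (rule add_divide_distrib)
  also have "\<dots> \<le> bounded_dist x u + bounded_dist u y"
    unfolding bounded_dist_def by (intro add_mono divide_left_mono mult_pos_pos) (auto intro: add_pos_nonneg)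
  finally show ?thesis .
qed

text \<open>Strict concavity of \<open>t / (1 + t)\<close> makes a detour of size \<open>d\<close> cost a definite fraction.\<close>

lemma bounded_dist_detour:
  assumes d: "0 < d"
  obtains b where "0 < b" "b \<le> 1" and "\<And>x a a'. d \<le> dist a x \<Longrightarrow> d \<le> dist x a' \<Longrightarrow>
    bounded_dist a a' \<le> (1 - b) * (bounded_dist a x + bounded_dist x (a'::'a::metric_space))"
proof -
  \<comment> \<open>The saving \<open>?f s + ?f t - ?f (s + t)\<close> is at least the product of
    \<open>?f t\<close> and \<open>s / (1 + s + t)\<close>; for \<open>d <= t <= s\<close> these are
    bounded below by the two factors of \<open>k\<close>.\<close>
  define k where "k = d / (1 + d) * (d / (1 + 2 * d))"
  have k: "0 < k" "k \<le> 1"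
    unfolding k_def using d by (simp, intro mult_le_one) auto
  let ?f = "\<lambda>t::real. t / (1 + t)"
  have key: "?f (s + t) \<le> ?f s + ?f t - k" if "d \<le> t" "t \<le> s" for s t
  proof -
    have pos: "0 < t" "0 < s" using that d by auto
    have "d / (1 + 2 * d) \<le> s / (1 + 2 * s)" using that d by (simp add: field_simps)
    also have "\<dots> \<le> s / (1 + s + t)" using that pos by (intro divide_left_mono mult_pos_pos) auto
    finally have "k \<le> ?f t * (s / (1 + s + t))"
      unfolding k_def using d that pos by (intro mult_mono divide_one_plus_mono) auto
    moreover have "?f t - t / (1 + s + t) = ?f t * (s / (1 + s + t))"
      using pos by (simp add: divide_simps) (simp add: algebra_simps)
    moreover have "s / (1 + s + t) \<le> ?f s" using pos by (intro divide_left_mono mult_pos_pos) auto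
    moreover have "?f (s + t) = s / (1 + s + t) + t / (1 + s + t)"
      by (simp add: add_divide_distrib add.assoc)
    ultimately show ?thesis by linarith
  qed
  have key': "?f (s + t) \<le> ?f s + ?f t - k" if "d \<le> t" "d \<le> s" for s t
    using key[of t s] key[of s t] that by (cases "t \<le> s") (auto simp: add.commute)
  show thesis
  proof
    \<comment> \<open>Both summands are at most 1, so a saving of \<open>k\<close> is at least the
      fraction \<open>k / 2\<close> of their sum.\<close>
    show "0 < k / 2" "k / 2 \<le> 1" using k by auto
    fix x a a' :: 'a assume far: "d \<le> dist a x" "d \<le> dist x a'"
    have "bounded_dist a a' \<le> ?f (dist a x + dist x a')"
      unfolding bounded_dist_def by (intro divide_one_plus_mono dist_triangle) auto
    also have "\<dots> \<le> bounded_dist a x + bounded_dist x a' - k"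
      using key'[OF far(2,1)] by (simp add: bounded_dist_def)
    also have "\<dots> \<le> (1 - k / 2) * (bounded_dist a x + bounded_dist x a')"
    proof -
      have "bounded_dist y z \<le> 1" for y z :: 'a
        by (simp add: bounded_dist_def divide_le_eq add_pos_nonneg)
      then have "bounded_dist a x + bounded_dist x a' \<le> 2" by (smt (verit))
      then have "k / 2 * (bounded_dist a x + bounded_dist x a') \<le> k / 2 * 2"
        using k by (intro mult_left_mono) auto
      then show ?thesis by (simp add: algebra_simps)
    qed
    finally show "bounded_dist a a' \<le> (1 - k / 2) * (bounded_dist a x + bounded_dist x a')" .
  qed
qed

section \<open>Coordinates of the support\<close>

lemma evb_apply: "g \<in> Cb_tilde \<Longrightarrow> evb p g = g p"
  by (simp add: evb_def)

text \<open>The function \<open>g0\<close> on pairs; its extension to \<open>betaM\<close> is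
  evaluation at \<open>closeness\<close>. The value 0 on the diagonal is the convention of
  \<open>Cb_tilde\<close>.\<close>

definition closeness :: "'a::metric_space \<times> 'a \<Rightarrow> real" where
  "closeness = (\<lambda>p. if p \<in> Mtilde then 1 / (1 + dist (fst p) (snd p)) else 0)"

lemma one_plus_dist_neq_0 [simp]: "1 + dist x y \<noteq> (0::real)"
  by (smt (verit) zero_le_dist)

lemma closeness_in_Cb_tilde: "closeness \<in> Cb_tilde"
  unfolding closeness_def
  by (rule restrict_Mtilde_in_Cb_tilde[where B = 1])
    (auto intro!: continuous_intros simp: divide_le_eq add_pos_nonneg)

lemma dist_closeness: "x \<noteq> y \<Longrightarrow> dist x y * closeness (x, y) = bounded_dist x y"
  by (simp add: closeness_def bounded_dist_def Mtilde_def)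

lemma closeness_in_Gset: "(\<lambda>\<xi>. \<xi> closeness) \<in> Gset"
  unfolding Gset_def using bounded_dist_triangle
  by (auto simp: evb_apply[OF closeness_in_Cb_tilde] dist_closeness intro!: continuous_on_eval)

lemma closeness_nonneg:
  assumes "\<xi> \<in> betaM"
  shows "0 \<le> \<xi> closeness"
  by (rule betaM_nonneg[OF continuous_on_eval open_UNIV UNIV_I assms])
    (simp add: evb_apply[OF closeness_in_Cb_tilde], simp add: closeness_def)

lemma min_dist_in_Cb_tilde:
  "(\<lambda>p. if p \<in> Mtilde then min (dist (fst p) (snd p)) (real n) else 0) \<in> Cb_tilde"
  by (rule restrict_Mtilde_in_Cb_tilde[where B = "real n"]) (auto intro!: continuous_intros)

text \<open>If the claim failed at a point with \<open>dext \<xi> = R\<close> finite, density would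
  produce a genuine pair at distance below \<open>R + 1\<close> whose closeness is below
  \<open>1 / (R + 2)\<close>, which is impossible.\<close>

lemma closeness_pos:
  fixes \<xi> :: "('a::metric_space \<times> 'a \<Rightarrow> real) \<Rightarrow> real"
  assumes \<xi>: "\<xi> \<in> betaM" and fin: "dext \<xi> \<noteq> \<infinity>"
  shows "0 < \<xi> closeness"
proof (rule ccontr)
  assume "\<not> 0 < \<xi> closeness"
  let ?d = "\<lambda>n (p :: 'a \<times> 'a). if p \<in> Mtilde then min (dist (fst p) (snd p)) (real n) else 0"
  have "dext \<xi> \<noteq> - \<infinity>"
  proof -
    have "ereal (\<xi> (?d 0)) \<le> dext \<xi>" unfolding dext_def by (rule SUP_upper) simp
    then show ?thesis by auto
  qed
  then obtain R where R: "dext \<xi> = ereal R" using fin by (cases "dext \<xi>") auto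
  have le: "\<xi> (?d n) \<le> R" for n
  proof -
    have "ereal (\<xi> (?d n)) \<le> dext \<xi>" unfolding dext_def by (rule SUP_upper) simp
    then show ?thesis by (simp add: R)
  qed
  \<comment> \<open>With this truncation level, a truncated distance below \<open>R + 1\<close> is
    the true distance.\<close>
  obtain n where n: "R + 1 < real n" using reals_Archimedean2 by blast
  have R0: "0 \<le> R"
    using le[of 0] betaM_nonneg[OF continuous_on_eval[of _ "?d 0"] open_UNIV UNIV_I \<xi>]
    by (force simp: evb_apply[OF min_dist_in_Cb_tilde])
  let ?W = "{\<eta>. \<eta> (?d n) < R + 1} \<inter> {\<eta>. \<eta> closeness < 1 / (R + 2)}"
  have "open ?W"
    by (intro open_Int open_Collect_less continuous_on_const continuous_on_eval)
  moreover have "\<xi> \<in> ?W"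
  proof -
    have "\<xi> closeness < 1 / (R + 2)"
      by (rule le_less_trans[of _ 0]) (use R0 \<open>\<not> 0 < \<xi> closeness\<close> in auto)
    then show ?thesis using le[of n] by simp
  qed
  ultimately obtain p where p: "p \<in> Mtilde" "evb p \<in> ?W" using betaM_dense \<xi> by blast
  have "evb p \<in> {\<eta>. \<eta> (?d n) < R + 1}" using p(2) by (rule IntD1)
  then have "?d n p < R + 1" unfolding mem_Collect_eq evb_apply[OF min_dist_in_Cb_tilde] .
  moreover have "evb p \<in> {\<eta>. \<eta> closeness < 1 / (R + 2)}" using p(2) by (rule IntD2)
  then have "closeness p < 1 / (R + 2)" unfolding mem_Collect_eq evb_apply[OF closeness_in_Cb_tilde] .
  ultimately have "dist (fst p) (snd p) < R + 1" and small: "1 / (1 + dist (fst p) (snd p)) < 1 / (R + 2)"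
    using p(1) n by (simp_all only: closeness_def if_True min_less_iff_disj) auto
  then have "1 / (R + 2) \<le> 1 / (1 + dist (fst p) (snd p))"
    using R0 by (intro divide_left_mono mult_pos_pos) (auto intro: add_pos_nonneg)
  then show False using small by simp
qed

lemma difference_quotient_in_Cb_tilde:
  fixes u :: "'a::metric_space \<Rightarrow> real"
  assumes u: "\<And>x y. \<bar>u x - u y\<bar> \<le> C * dist x y"
  shows "(\<lambda>p. (u (fst p) - u (snd p)) / dist (fst p) (snd p)) \<in> Cb_tilde"
proof -
  have "\<bar>C\<bar>-lipschitz_on UNIV u"
  proof (rule lipschitz_onI)
    show "dist (u x) (u y) \<le> \<bar>C\<bar> * dist x y" for x y
      using u[of x y] mult_right_mono[OF abs_ge_self[of C], of "dist x y"] by (simp add: dist_real_def)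
  qed simp
  then have cont: "continuous_on UNIV u" by (rule lipschitz_on_continuous_on)
  have "(\<lambda>p. if p \<in> Mtilde then (u (fst p) - u (snd p)) / dist (fst p) (snd p) else 0) \<in> Cb_tilde"
  proof (rule restrict_Mtilde_in_Cb_tilde[where B = C])
    show "continuous_on Mtilde (\<lambda>p. (u (fst p) - u (snd p)) / dist (fst p) (snd p))"
      by (intro continuous_intros continuous_on_compose2[OF cont]) (auto simp: Mtilde_def)
    show "\<bar>(u (fst p) - u (snd p)) / dist (fst p) (snd p)\<bar> \<le> C" if "p \<in> Mtilde" for p
      using u[of "fst p" "snd p"] that by (simp add: Mtilde_def divide_le_eq)
  qed
  \<comment> \<open>On the diagonal the quotient is already 0.\<close>
  also have "(\<lambda>p. if p \<in> Mtilde then (u (fst p) - u (snd p)) / dist (fst p) (snd p) else 0)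
    = (\<lambda>p. (u (fst p) - u (snd p)) / dist (fst p) (snd p))"
    by (auto simp: Mtilde_def)
  finally show ?thesis .
qed

section \<open>Distance of one coordinate to a set\<close>

lemma min_infdist_in_Cb_tilde:
  assumes "\<pi> = fst \<or> \<pi> = snd"
  shows "(\<lambda>p. if p \<in> Mtilde then min (infdist (\<pi> p) A) 1 else 0) \<in> Cb_tilde"
  by (rule restrict_Mtilde_in_Cb_tilde[where B = 1])
    (use assms in \<open>auto intro!: continuous_intros simp: infdist_nonneg\<close>)

lemma comp_in_Cb_tilde:
  fixes f :: "'a::metric_space \<Rightarrow> real"
  assumes \<pi>: "\<pi> = fst \<or> \<pi> = snd" and f: "f \<in> Ub"
  shows "(\<lambda>p. if p \<in> Mtilde then f (\<pi> p) else 0) \<in> Cb_tilde"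
proof -
  have f': "continuous_on UNIV f" using f by (auto simp: Ub_def uniformly_continuous_imp_continuous)
  obtain B where "\<And>x. \<bar>f x\<bar> \<le> B" using f by (auto simp: Ub_def bounded_iff)
  then show ?thesis
    using \<pi> by (intro restrict_Mtilde_in_Cb_tilde[where B = B])
      (auto intro!: continuous_on_compose2[OF f'] continuous_intros)
qed

lemma tendsto_fun:
  fixes X :: "'i \<Rightarrow> 'b::topological_space"
  assumes "\<And>i. ((\<lambda>t. f t i) \<longlongrightarrow> X i) F"
  shows "(f \<longlongrightarrow> X) F"
proof -
  have "limitin (product_topology (\<lambda>i. euclidean) UNIV) f X F"
    unfolding limitin_componentwise using assms by simp
  then show ?thesis by (simp add: euclidean_product_topology)
qed

text \<open>Along pairs tending to \<open>\<zeta>\<close> the coordinate comes arbitrarily close to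
  \<open>A\<close> and can be replaced by points of \<open>A\<close>; uniformly continuous functions
  do not notice the change in the limit. The parameter \<open>\<pi>\<close> treats \<open>p1\<close>
  and \<open>p2\<close> at once.\<close>

lemma coordinate_in_closure:
  fixes \<zeta> :: "('a::metric_space \<times> 'a \<Rightarrow> real) \<Rightarrow> real"
  assumes \<pi>: "\<pi> = fst \<or> \<pi> = snd" and \<zeta>: "\<zeta> \<in> betaM" and A: "A \<noteq> {}"
    and near: "\<zeta> (\<lambda>p. if p \<in> Mtilde then min (infdist (\<pi> p) A) 1 else 0) \<le> 0"
  shows "(\<lambda>f. if f \<in> Ub then \<zeta> (\<lambda>p. if p \<in> Mtilde then f (\<pi> p) else 0) else 0) \<in> closure (evu ` A)"
proof -
  let ?m = "\<lambda>p. if p \<in> Mtilde then min (infdist (\<pi> p) A) 1 else 0"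
  define F where "F = inf (filtercomap evb (nhds \<zeta>)) (principal (Mtilde :: ('a \<times> 'a) set))"
  \<comment> \<open>The second component is a slack tending to 0 from above, since nearest points of
    \<open>A\<close> need not exist.\<close>
  define G where "G = F \<times>\<^sub>F at_right (0::real)"
  have "F \<noteq> bot"
  proof
    assume "F = bot"
    then have "eventually (\<lambda>p. False) F" by simp
    then obtain Q where "eventually Q (filtercomap evb (nhds \<zeta>))" "\<And>p. Q p \<Longrightarrow> p \<notin> Mtilde"
      unfolding F_def eventually_inf_principal by blast
    then obtain W where W: "open W" "\<zeta> \<in> W" "\<And>p. evb p \<in> W \<Longrightarrow> p \<notin> Mtilde"
      unfolding eventually_filtercomap eventually_nhds by blast
    show False using betaM_dense[OF W(1,2) \<zeta>] W(3) by blast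
  qed
  then have G: "G \<noteq> bot" unfolding G_def by (simp add: prod_filter_eq_bot trivial_limit_at_right_real)
  have fstG: "filterlim fst F G" unfolding G_def by (rule filterlim_fst)
  have sndG: "filterlim snd (at_right 0) G" unfolding G_def by (rule filterlim_snd)
  have lim: "((\<lambda>p. g p) \<longlongrightarrow> \<zeta> g) F" if "g \<in> Cb_tilde" for g
  proof -
    have "(evb \<longlongrightarrow> \<zeta>) F"
      unfolding F_def by (rule filterlim_mono[OF filterlim_filtercomap order_refl]) simp
    then have "((\<lambda>p. evb p g) \<longlongrightarrow> \<zeta> g) F"
      by (rule continuous_on_tendsto_compose[OF continuous_on_eval[of UNIV g]]) auto
    then show ?thesis by (simp add: evb_apply[OF that])
  qed
  have inM: "eventually (\<lambda>q. fst q \<in> Mtilde) G"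
    by (rule eventually_compose_filterlim[OF _ fstG]) (simp add: F_def eventually_inf_principal)
  have rpos: "eventually (\<lambda>q. snd q > 0) G"
    by (rule eventually_compose_filterlim[OF _ sndG]) (simp add: eventually_at_right_less)
  have ex: "\<exists>a. a \<in> A \<and> (r > 0 \<longrightarrow> dist x a < infdist x A + r)" for x and r :: real
  proof (cases "r > 0")
    case True
    have "Inf ((\<lambda>a. dist x a) ` A) < infdist x A + r" using A True by (simp add: infdist_def)
    then show ?thesis using cInf_lessD[of "(\<lambda>a. dist x a) ` A"] A by fastforce
  qed (use A in auto)
  define sel where "sel x r = (SOME a. a \<in> A \<and> (r > 0 \<longrightarrow> dist x a < infdist x A + r))" for x r
  have sel: "sel x r \<in> A" "r > 0 \<Longrightarrow> dist x (sel x r) < infdist x A + r" for x r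
    using someI_ex[OF ex[of r x]] by (simp_all add: sel_def)
  let ?a = "\<lambda>q. sel (\<pi> (fst q)) (snd q)"
  have m0: "((\<lambda>q. ?m (fst q) + snd q) \<longlongrightarrow> \<zeta> ?m + 0) G"
  proof (rule tendsto_add)
    show "((\<lambda>q. ?m (fst q)) \<longlongrightarrow> \<zeta> ?m) G"
      by (rule filterlim_compose[OF lim[OF min_infdist_in_Cb_tilde[OF \<pi>]] fstG])
    show "(snd \<longlongrightarrow> 0) G" using sndG by (simp add: filterlim_at)
  qed
  have dist0: "eventually (\<lambda>q. dist (\<pi> (fst q)) (?a q) < d) G" if "0 < d" for d
  proof -
    \<comment> \<open>Staying below 1 ensures that the minimum in \<open>?m\<close> is the true
      distance.\<close>
    have "eventually (\<lambda>q. ?m (fst q) + snd q < min d 1) G"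
      by (rule order_tendstoD(2)[OF m0]) (use near that in auto)
    then show ?thesis
      using inM rpos
    proof eventually_elim
      case (elim q)
      then have "infdist (\<pi> (fst q)) A + snd q < d" by (auto simp: min_def split: if_splits)
      then show ?case using sel(2)[of "snd q" "\<pi> (fst q)"] elim by linarith
    qed
  qed
  let ?P = "\<lambda>f. if f \<in> Ub then \<zeta> (\<lambda>p. if p \<in> Mtilde then f (\<pi> p) else 0) else 0"
  have lim_evu: "((\<lambda>q. evu (?a q)) \<longlongrightarrow> ?P) G"
  proof (rule tendsto_fun)
    fix f :: "'a \<Rightarrow> real"
    show "((\<lambda>q. evu (?a q) f) \<longlongrightarrow> ?P f) G"
    proof (cases "f \<in> Ub")
      case True
      have "((\<lambda>q. if fst q \<in> Mtilde then f (\<pi> (fst q)) else 0) \<longlongrightarrow> ?P f) G"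
        using filterlim_compose[OF lim[OF comp_in_Cb_tilde[OF \<pi> True]] fstG] True by simp
      then have 1: "((\<lambda>q. f (\<pi> (fst q))) \<longlongrightarrow> ?P f) G"
        by (rule Lim_transform_eventually) (use inM in eventually_elim, simp)
      have 2: "((\<lambda>q. f (\<pi> (fst q)) - f (?a q)) \<longlongrightarrow> 0) G"
      proof (rule tendstoI)
        fix e :: real assume "e > 0"
        moreover have "uniformly_continuous_on UNIV f" using True by (simp add: Ub_def)
        ultimately obtain d where d: "d > 0" "\<And>x y. dist x y < d \<Longrightarrow> dist (f x) (f y) < e"
          unfolding uniformly_continuous_on_def by blast
        show "eventually (\<lambda>q. dist (f (\<pi> (fst q)) - f (?a q)) 0 < e) G"
          using dist0[OF d(1)] by eventually_elim (use d(2) in \<open>simp add: dist_real_def\<close>)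
      qed
      show ?thesis using tendsto_diff[OF 1 2] True by (simp add: evu_def)
    qed (simp add: evu_def)
  qed
  show ?thesis
    by (rule Lim_in_closed_set[OF closed_closure _ G lim_evu])
      (use sel(1) in \<open>auto intro!: always_eventually subsetD[OF closure_subset]\<close>)
qed

section \<open>The main estimate\<close>

lemma dext_infinite_measurable:
  fixes \<mu> :: "(('a::metric_space \<times> 'a \<Rightarrow> real) \<Rightarrow> real) measure"
  assumes \<mu>: "radon_on betaM \<mu>"
  shows "{\<xi> \<in> betaM. dext \<xi> = \<infinity>} \<in> sets \<mu>"
proof -
  have eval: "(\<lambda>\<xi>. \<xi> g) \<in> borel_measurable \<mu>" for g :: "'a \<times> 'a \<Rightarrow> real"
    using radon_integrable[OF compact_betaM \<mu> continuous_on_eval] by (rule borel_measurable_integrable)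
  have "dext \<in> borel_measurable \<mu>"
    unfolding dext_def[abs_def] by (intro borel_measurable_SUP borel_measurable_ereal eval) auto
  then have "{\<xi> \<in> space \<mu>. dext \<xi> = \<infinity>} \<in> sets \<mu>" by measurable
  then show ?thesis using \<mu> by (simp add: radon_on_def)
qed

text \<open>\<open>Gset\<close> speaks of distinct points only. The case \<open>x = y\<close> needs
  the round trip from \<open>x\<close> to \<open>u\<close> and back to have nonnegative cost; this
  follows by adding two triangle inequalities through a third point \<open>w\<close>.\<close>

lemma Gset_triangle:
  fixes h :: "(('a::metric_space \<times> 'a \<Rightarrow> real) \<Rightarrow> real) \<Rightarrow> real"
  assumes three: "\<exists>a b c::'a. a \<noteq> b \<and> b \<noteq> c \<and> a \<noteq> c" and h: "h \<in> Gset"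
  shows "dist x y * h (evb (x, y)) \<le> dist x u * h (evb (x, u)) + dist u y * h (evb (u, y))"
proof -
  have "\<exists>w. w \<noteq> x \<and> w \<noteq> u" using three by metis
  then obtain w where w: "w \<noteq> x" "w \<noteq> u" by blast
  consider "x = u" | "u = y" | "x = y" "x \<noteq> u" | "x \<noteq> u" "u \<noteq> y" "x \<noteq> y" by blast
  then show ?thesis
  proof cases
    case 3
    have "dist w u * h (evb (w, u)) \<le> dist w x * h (evb (w, x)) + dist x u * h (evb (x, u))"
      "dist w x * h (evb (w, x)) \<le> dist w u * h (evb (w, u)) + dist u x * h (evb (u, x))"
      using GsetD(2)[OF h, of w x u] GsetD(2)[OF h, of w u x] w 3(2) by auto
    then show ?thesis using 3 by simp
  next
    case 4
    then show ?thesis using GsetD(2)[OF h, of x u y] by simp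
  qed auto
qed

text \<open>The contradiction argument of the overview: a positive value here means that the
  coordinate of \<open>\<zeta>\<close> stays away from \<open>A\<close>. Having \<open>z\<close> in
  \<open>A\<close> puts the potential into \<open>Lip0 z\<close>.\<close>

lemma minimal_coordinate_near:
  fixes z :: "'a::metric_space"
    and \<mu> :: "(('a \<times> 'a \<Rightarrow> real) \<Rightarrow> real) measure"
  assumes three: "\<exists>a b c::'a. a \<noteq> b \<and> b \<noteq> c \<and> a \<noteq> c"
    and radon: "radon_on betaM \<mu>" and minimal: "preceq_minimal \<mu>"
    and conc: "emeasure \<mu> {\<xi> \<in> betaM. dext \<xi> = \<infinity>} = 0"
    and \<pi>: "\<pi> = fst \<or> \<pi> = snd" and zA: "z \<in> A"
    and vanish: "\<And>f. f \<in> Lip0 z \<Longrightarrow> (\<And>x. x \<in> A \<Longrightarrow> f x = 0) \<Longrightarrow> Phi_star \<mu> f = 0"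
    and \<zeta>: "\<zeta> \<in> supp betaM \<mu>"
  shows "\<zeta> (\<lambda>p. if p \<in> Mtilde then min (infdist (\<pi> p) A) 1 else 0) \<le> 0"
proof (rule ccontr)
  let ?m = "\<lambda>p. if p \<in> Mtilde then min (infdist (\<pi> p) A) 1 else 0"
  assume "\<not> \<zeta> ?m \<le> 0"
  \<comment> \<open>\<open>d\<close> is both the threshold defining \<open>U\<close> and the detour
    size; strictness makes \<open>W\<close> an open neighbourhood of \<open>\<zeta>\<close>.\<close>
  then obtain d where d: "0 < d" "d < \<zeta> ?m" using dense[of 0 "\<zeta> ?m"] by (auto simp: not_le)
  define U where "U = {x. d < infdist x A}"
  define W where "W = {\<eta> :: ('a \<times> 'a \<Rightarrow> real) \<Rightarrow> real. d < \<eta> ?m}"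
  have A: "A \<noteq> {}" using zA by blast
  have space: "space \<mu> = betaM" and sets: "sets \<mu> = sets (restrict_space borel betaM)"
    using radon by (auto simp: radon_on_def)
  interpret finite_measure \<mu> using radon by (simp add: radon_on_def)
  note integrable = radon_integrable[OF compact_betaM radon]
  have W: "open W" unfolding W_def by (intro open_Collect_less continuous_on_const continuous_on_eval)
  have in_U: "\<pi> p \<in> U" if "p \<in> Mtilde" "evb p \<in> W" for p
    using that by (simp add: W_def U_def evb_apply[OF min_infdist_in_Cb_tilde[OF \<pi>]])
  have WB: "W \<inter> betaM \<in> sets \<mu>" using W by (auto simp: sets sets_restrict_space)
  obtain b where b: "0 < b" "b \<le> 1" and detour: "\<And>x a a'::'a. d \<le> dist a x \<Longrightarrow> d \<le> dist x a' \<Longrightarrow>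
    bounded_dist a a' \<le> (1 - b) * (bounded_dist a x + bounded_dist x a')"
    by (rule bounded_dist_detour[OF d(1)], rule that)
  let ?g0 = "\<lambda>\<xi> :: ('a \<times> 'a \<Rightarrow> real) \<Rightarrow> real. \<xi> closeness"
  let ?k = "\<lambda>\<xi>. indicator (W \<inter> betaM) \<xi> * ?g0 \<xi>"
  have int_g0: "integrable \<mu> ?g0" by (rule integrable[OF continuous_on_eval])
  have int_k: "integrable \<mu> ?k"
    using integrable_real_mult_indicator[OF WB int_g0] by (simp add: mult.commute)
  \<comment> \<open>Otherwise \<open>W\<close> would be null, because \<open>g0 > 0\<close> almost
    everywhere; but \<open>W\<close> is a neighbourhood of a support point.\<close>
  have "0 < integral\<^sup>L \<mu> ?k"
  proof -
    have k_nonneg: "AE \<xi> in \<mu>. 0 \<le> ?k \<xi>"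
      using closeness_nonneg by (intro AE_I2) (auto simp: space indicator_def)
    have "integral\<^sup>L \<mu> ?k \<noteq> 0"
    proof
      assume "integral\<^sup>L \<mu> ?k = 0"
      then have "AE \<xi> in \<mu>. ?k \<xi> = 0"
        using integral_nonneg_eq_0_iff_AE[OF int_k k_nonneg] by simp
      moreover have "AE \<xi> in \<mu>. dext \<xi> \<noteq> \<infinity>"
        using dext_infinite_measurable[OF radon] conc by (intro AE_I) (auto simp: space)
      ultimately have "AE \<xi> in \<mu>. \<xi> \<notin> W \<inter> betaM"
        by eventually_elim (use closeness_pos in \<open>force simp: indicator_def\<close>)
      then have "emeasure \<mu> (W \<inter> betaM) = 0"
        using WB by (subst (asm) AE_iff_measurable[OF WB]) (use sets.sets_into_space[OF WB] in auto)
      moreover have "\<zeta> \<in> W" using d(2) by (simp add: W_def)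
      ultimately show False using \<zeta> W by (auto simp: supp_def)
    qed
    then show ?thesis using integral_nonneg_AE[OF k_nonneg] by simp
  qed
  \<comment> \<open>The tolerance equals the gain on \<open>W\<close> obtained at the end, so that
    the strict inequality is contradictory.\<close>
  then obtain h where h: "h \<in> Gset" "\<And>\<xi>. \<xi> \<in> betaM \<Longrightarrow> - ?g0 \<xi> \<le> h \<xi>"
    "integral\<^sup>L \<mu> h < - integral\<^sup>L \<mu> ?g0 + b * integral\<^sup>L \<mu> ?k"
    using preceq_minimal_dual[OF radon minimal closeness_in_Gset, of "b * integral\<^sup>L \<mu> ?k"] b(1) by auto
  have h_cont: "continuous_on betaM h" by (rule GsetD(1)[OF h(1)])
  obtain H where H: "\<And>\<xi>. \<xi> \<in> betaM \<Longrightarrow> \<bar>h \<xi>\<bar> \<le> H"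
    using compact_imp_bounded[OF compact_continuous_image[OF h_cont compact_betaM]]
    by (auto simp: bounded_iff)
  define c where "c x y = dist x y * h (evb (x, y))" for x y
  obtain u where u: "\<And>x y. \<bar>u x - u y\<bar> \<le> (\<bar>H\<bar> + 1) * dist x y" "\<And>a. a \<in> A \<Longrightarrow> u a = 0"
    "\<And>x y. u y - u x \<le> c x y + bounded_dist x y"
    "\<And>x y. x \<in> U \<or> y \<in> U \<Longrightarrow> u y - u x \<le> c x y + (1 - b) * bounded_dist x y"
  \<comment> \<open>The Lipschitz constant is a bound for \<open>h\<close> plus 1, the latter from
    \<open>bounded_dist <= dist\<close>.\<close>
  proof (rule discounted_potential[of A b c bounded_dist "\<bar>H\<bar> + 1" U])
    show "c x y \<le> c x v + c v y" for x v y unfolding c_def by (rule Gset_triangle[OF three h(1)])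
    show "- bounded_dist x y \<le> c x y" for x y
    proof (cases "x = y")
      case False
      then have "evb (x, y) \<in> betaM" by (intro evb_in_betaM) (simp add: Mtilde_def)
      then have "dist x y * (- closeness (x, y)) \<le> c x y"
        unfolding c_def using h(2)[of "evb (x, y)"]
        by (intro mult_left_mono) (auto simp: evb_apply[OF closeness_in_Cb_tilde])
      then show ?thesis using dist_closeness[OF False] by simp
    qed (simp add: c_def bounded_dist_def)
    show "c x y + bounded_dist x y \<le> (\<bar>H\<bar> + 1) * dist x y" for x y
    proof (cases "x = y")
      case False
      then have "evb (x, y) \<in> betaM" by (intro evb_in_betaM) (simp add: Mtilde_def)
      then have "c x y \<le> dist x y * \<bar>H\<bar>"
        unfolding c_def using H[of "evb (x, y)"] by (intro mult_left_mono) auto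
      moreover have "bounded_dist x y \<le> dist x y"
        unfolding bounded_dist_def by (simp add: divide_le_eq add_pos_nonneg distrib_left)
      ultimately show ?thesis by (simp add: algebra_simps)
    qed (simp add: c_def bounded_dist_def)
    show "bounded_dist a a' \<le> (1 - b) * (bounded_dist a x + bounded_dist x a')"
      if "a \<in> A" "a' \<in> A" "x \<in> U" for a a' x
      using that infdist_le[of a A x] infdist_le[of a' A x]
      by (intro detour) (auto simp: U_def dist_commute)
  qed (use A b bounded_dist_triangle in \<open>auto simp: c_def bounded_dist_def\<close>)
  note quot = difference_quotient_in_Cb_tilde[OF u(1)]
  have Phi_cont: "continuous_on S (Phi u)" for S
    unfolding Phi_def[abs_def] by (rule continuous_on_eval)
  have Phi_evb: "dist (fst p) (snd p) * Phi u (evb p) = u (fst p) - u (snd p)" if "p \<in> Mtilde" for p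
    using that by (simp add: Phi_def evb_apply[OF quot] Mtilde_def)
  have pos: "0 < dist (fst p) (snd p)" if "p \<in> Mtilde" for p :: "'a \<times> 'a"
    using that by (simp add: Mtilde_def)
  have lower: "0 \<le> h \<xi> + ?g0 \<xi> + Phi u \<xi>" if "\<xi> \<in> betaM" for \<xi>
  proof (rule betaM_nonneg[OF _ open_UNIV UNIV_I that])
    show "continuous_on betaM (\<lambda>\<xi>. h \<xi> + ?g0 \<xi> + Phi u \<xi>)"
      by (intro continuous_intros h_cont Phi_cont continuous_on_eval)
    fix p :: "'a \<times> 'a" assume p: "p \<in> Mtilde"
    \<comment> \<open>The cost inequality for the step from \<open>fst p\<close> to
      \<open>snd p\<close>, to be divided by the distance.\<close>
    have "0 \<le> dist (fst p) (snd p) * (h (evb p) + evb p closeness + Phi u (evb p))"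
      using u(3)[of "snd p" "fst p"] dist_closeness[of "fst p" "snd p"] Phi_evb[OF p] p
      by (simp add: distrib_left c_def evb_apply[OF closeness_in_Cb_tilde] Mtilde_def)
    then show "0 \<le> h (evb p) + evb p closeness + Phi u (evb p)"
      using pos[OF p] by (simp add: zero_le_mult_iff)
  qed
  have lower_W: "0 \<le> h \<xi> + (1 - b) * ?g0 \<xi> + Phi u \<xi>" if "\<xi> \<in> betaM" "\<xi> \<in> W" for \<xi>
  proof (rule betaM_nonneg[OF _ W that(2,1)])
    show "continuous_on betaM (\<lambda>\<xi>. h \<xi> + (1 - b) * ?g0 \<xi> + Phi u \<xi>)"
      by (intro continuous_intros h_cont Phi_cont continuous_on_eval)
    fix p :: "'a \<times> 'a" assume p: "p \<in> Mtilde" "evb p \<in> W"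
    have "0 \<le> dist (fst p) (snd p) * (h (evb p) + (1 - b) * evb p closeness + Phi u (evb p))"
      using u(4)[of "fst p" "snd p"] dist_closeness[of "fst p" "snd p"] Phi_evb[OF p(1)] p in_U[OF p] \<pi>
      by (auto simp: distrib_left c_def evb_apply[OF closeness_in_Cb_tilde] Mtilde_def
          mult.left_commute[of _ "1 - b"])
    then show "0 \<le> h (evb p) + (1 - b) * evb p closeness + Phi u (evb p)"
      using pos[OF p(1)] by (simp add: zero_le_mult_iff)
  qed
  \<comment> \<open>On \<open>W\<close> the bound \<open>lower_W\<close> leaves the surplus
    \<open>b g0\<close>; elsewhere \<open>lower\<close> suffices.\<close>
  have "integral\<^sup>L \<mu> (\<lambda>\<xi>. b * ?k \<xi>) \<le> integral\<^sup>L \<mu> (\<lambda>\<xi>. h \<xi> + ?g0 \<xi> + Phi u \<xi>)"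
  proof (rule integral_mono)
    show "integrable \<mu> (\<lambda>\<xi>. b * ?k \<xi>)" using int_k by simp
    show "integrable \<mu> (\<lambda>\<xi>. h \<xi> + ?g0 \<xi> + Phi u \<xi>)"
      by (intro integrable continuous_intros h_cont Phi_cont continuous_on_eval)
    show "b * ?k \<xi> \<le> h \<xi> + ?g0 \<xi> + Phi u \<xi>" if "\<xi> \<in> space \<mu>" for \<xi>
      using lower[of \<xi>] lower_W[of \<xi>] that by (cases "\<xi> \<in> W") (auto simp: space algebra_simps)
  qed
  also have "\<dots> = integral\<^sup>L \<mu> h + integral\<^sup>L \<mu> ?g0 + integral\<^sup>L \<mu> (Phi u)"
    using integrable[OF h_cont] int_g0 integrable[OF Phi_cont] by simp
  also have "integral\<^sup>L \<mu> (Phi u) = 0"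
  proof -
    have "(\<bar>H\<bar> + 1)-lipschitz_on UNIV u"
      using u(1) by (auto simp: lipschitz_on_def dist_real_def)
    then have "u \<in> Lip0 z" using u(2)[OF zA] by (auto simp: Lip0_def)
    then show ?thesis using vanish[of u] u(2) by (simp add: Phi_star_def)
  qed
  finally show False using h(3) by simp
qed

text \<open>\<open>A\<close> may miss the base point or be empty, so the estimate is applied to
  \<open>insert z A\<close>; functions vanishing there vanish on \<open>A\<close>. The closed
  singleton \<open>{evu z}\<close> then splits off the closure, which explains the extra point in
  the conclusion.\<close>

lemma coordinate_in_esupp:
  fixes z :: "'a::metric_space"
    and \<mu> :: "(('a \<times> 'a \<Rightarrow> real) \<Rightarrow> real) measure"
  assumes three: "\<exists>a b c::'a. a \<noteq> b \<and> b \<noteq> c \<and> a \<noteq> c"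
    and radon: "radon_on betaM \<mu>" and minimal: "preceq_minimal \<mu>"
    and conc: "emeasure \<mu> {\<xi> \<in> betaM. dext \<xi> = \<infinity>} = 0"
    and \<pi>: "\<pi> = fst \<or> \<pi> = snd" and \<zeta>: "\<zeta> \<in> supp betaM \<mu>"
  shows "(\<lambda>f. if f \<in> Ub then \<zeta> (\<lambda>p. if p \<in> Mtilde then f (\<pi> p) else 0) else 0)
    \<in> esupp z (Phi_star \<mu>) \<union> {evu z}"
proof -
  let ?P = "\<lambda>f. if f \<in> Ub then \<zeta> (\<lambda>p. if p \<in> Mtilde then f (\<pi> p) else 0) else 0"
  have "?P \<in> closure (evu ` A)"
    if A: "\<forall>f\<in>Lip0 z. (\<forall>x\<in>A. f x = 0) \<longrightarrow> Phi_star \<mu> f = 0" and ne: "?P \<noteq> evu z" for A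
  proof -
    have "?P \<in> closure (evu ` insert z A)"
      using \<zeta> A by (intro coordinate_in_closure \<pi> minimal_coordinate_near[OF three radon minimal conc \<pi>, of z])
        (auto simp: supp_def)
    also have "evu ` insert z A = {evu z} \<union> evu ` A" by simp
    also have "closure \<dots> = {evu z} \<union> closure (evu ` A)"
      using closedin_Hausdorff_singleton[OF Hausdorff_space_fun, of "evu z"]
      unfolding closure_Un by (simp add: closure_closed)
    finally show ?thesis using ne by simp
  qed
  then show ?thesis unfolding esupp_def by blast
qed

theorem theorem4p3:
  fixes z :: "'a::complete_space"
    and \<mu> :: "(('a \<times> 'a \<Rightarrow> real) \<Rightarrow> real) measure"
  assumes three: "\<exists>a b c::'a. a \<noteq> b \<and> b \<noteq> c \<and> a \<noteq> c"
    and radon: "radon_on betaM \<mu>"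
    and minimal: "preceq_minimal \<mu>"
    and conc: "emeasure \<mu> {\<xi> \<in> betaM. dext \<xi> = \<infinity>} = 0"
  shows "p1 ` supp betaM \<mu> \<union> p2 ` supp betaM \<mu> \<subseteq> esupp z (Phi_star \<mu>) \<union> {evu z}"
proof (intro Un_least image_subsetI)
  fix \<zeta> assume \<zeta>: "\<zeta> \<in> supp betaM \<mu>"
  show "p1 \<zeta> \<in> esupp z (Phi_star \<mu>) \<union> {evu z}"
    unfolding p1_def by (rule coordinate_in_esupp[OF three radon minimal conc _ \<zeta>, where \<pi> = fst]) simp
  show "p2 \<zeta> \<in> esupp z (Phi_star \<mu>) \<union> {evu z}"
    unfolding p2_def by (rule coordinate_in_esupp[OF three radon minimal conc _ \<zeta>, where \<pi> = snd]) simp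
qed

end
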